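(* Let $1<p,q<\infty$. For $\alpha,\sigma,\rho>0$ let $v_\alpha(z,t)=(|z|^4+16t^2)^{\alpha/4}$ on $\mathbb{H}^n$, and on $\Omega\times\mathbb{C}^n$ let $u_{\sigma,\rho}(a,w)=((2k+n)|\lambda|)^{-\sigma}|w|^{-\rho}$ for $a=(\lambda,(2k+n)|\lambda|)$ with $|\lambda|>1$ and $w\ne0$, and $u_{\sigma,\rho}(a,w)=0$ otherwise. Suppose that Pitt's inequality holds for these weights, i.e. there is a constant $C$ such that for all $f\in\mathcal{S}(\mathbb{H}^n)$, $$\left(\int_{\Omega\times\mathbb{C}^n}|\tilde f(a,w)|^q\,u_{\sigma,\rho}(a,w)^q\,dw\,d\nu_2(a)\right)^{1/q}\le C\left(\int_{\mathbb{H}^n}|f(z,t)|^p\,v_\alpha(z,t)^p\,dz\,dt\right)^{1/p}.$$ Then the following conditions necessarily hold: $$0<\alpha,\quad 0<\sigma,\quad 0<\rho,\quad \alpha p'<2(1+n),\quad q\rho<2n,$$ and $$\begin{aligned} -\frac{\alpha}{2}+\frac{n+1}{p'}+\frac{2n-q\rho}{2q}+\frac{-2n+q\sigma-1}{q}&\ge0 &&\text{if } q\sigma<2n+1,\\ -\frac{\alpha}{2}+\frac{n+1}{p'}+\frac{2n-q\rho}{2q}&>0 &&\text{if } q\sigma=2n+1,\\ -\frac{\alpha}{2}+\frac{n+1}{p'}+\frac{2n-q\rho}{2q}&\ge0 &&\text{if } q\sigma>2n+1. \end{aligned}$$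
   Context: The Heisenberg group $\mathbb{H}^n=\mathbb{C}^n\times\mathbb{R}$ ($n\ge1$) has group law $(z,t)(w,s)=(z+w,\,t+s+\frac12\operatorname{Im}(z\cdot\bar w))$, with Lebesgue (Haar) measure $dz\,dt$; $\mathcal{S}(\mathbb{H}^n)$ is the Schwartz space on $\mathbb{C}^n\times\mathbb{R}$. For $\delta>-1$, $k\in\{0,1,2,\dots\}$, the Laguerre polynomial is $L_k^\delta(t)=\frac{t^{-\delta}e^t}{k!}\left(\frac{d}{dt}\right)^k(e^{-t}t^{k+\delta})$. For $\lambda\in\mathbb{R}^*=\mathbb{R}\setminus\{0\}$ put $\varphi^{n-1}_{k,\lambda}(z)=L^{n-1}_k(\frac12|\lambda||z|^2)e^{-\frac14|\lambda||z|^2}$ and $e^{n-1}_{k,\lambda}(z,t)=e^{i\lambda t}\varphi^{n-1}_{k,\lambda}(z)$. The Heisenberg fan $\Omega$ is the union of the rays $R_k=\{(\lambda,(2k+n)|\lambda|):\lambda\in\mathbb{R}^*\}$, $k=0,1,2,\dots$, and $R_\infty=\{(0,\tau):\tau\ge0\}$. The Strichartz Fourier transform of $f$ is the function on $\Omega\times\mathbb{C}^n$ given by $\widehat f(a,w)=\int_{\mathbb{H}^n}f(z,t)\,e_a((z,t)^{-1}(w,0))\,dz\,dt$ for $a=(\lambda,(2k+n)|\lambda|)\in R_k$, where $e_a=e^{n-1}_{k,\lambda}$, and $\widehat f(0,\tau,w)=(n-1)!\,2^{n-1}\int_{\mathbb{H}^n}f(z,t)\frac{J_{n-1}(\sqrt\tau|w-z|)}{(\sqrt\tau|w-z|)^{n-1}}\,dz\,dt$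 on $R_\infty$ ($J_{n-1}$ the Bessel function). The normalized transform is $\tilde f(a,w)=\frac{k!(n-1)!}{(k+n-1)!}\widehat f(a,w)$ for $a\in R_k$ and $\tilde f(0,\tau,w)=\widehat f(0,\tau,w)$. The measure $\nu_2$ on $\Omega$ is defined by $$\int_\Omega\phi(a)\,d\nu_2(a)=(2\pi)^{-2n-1}\int_{-\infty}^\infty\left(\sum_{k=0}^\infty\left(\frac{(k+n-1)!}{k!(n-1)!}\right)^2\phi(\lambda,(2k+n)|\lambda|)\right)|\lambda|^{2n}\,d\lambda.$$ $p'$ is the Hölder conjugate of $p$. *)

theory Defs
  imports "HOL-Analysis.Analysis"
begin

section \<open>Schwartz functions\<close>

fun iter_deriv ::
  "('a::real_normed_vector \<Rightarrow> 'b::real_normed_vector) \<Rightarrow> 'a list \<Rightarrow> 'a \<Rightarrow> 'b" where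
  "iter_deriv f [] = f"
| "iter_deriv f (v # vs) = (\<lambda>x. frechet_derivative (iter_deriv f vs) (at x) v)"

text \<open>All iterated partial derivatives exist, are differentiable everywhere (hence the function is
  smooth) and decay faster than any power of the norm.\<close>

definition schwartz :: "('a::euclidean_space \<Rightarrow> 'b::real_normed_vector) \<Rightarrow> bool" where
  "schwartz f \<longleftrightarrow>
     (\<forall>vs \<in> lists Basis.
        (\<forall>x. iter_deriv f vs differentiable (at x)) \<and>
        (\<forall>N::nat. \<exists>B. \<forall>x. norm x ^ N * norm (iter_deriv f vs x) \<le> B))"

section \<open>The Heisenberg group\<close>

text \<open>The underlying space is \<open>\<complex>\<^sup>n \<times> \<real>\<close> with \<open>n = CARD('n)\<close>; Haar measure is \<open>lborel\<close>.\<close>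

type_synonym 'n heis = "(complex ^ 'n) \<times> real"

fun heis_mult :: "'n::finite heis \<Rightarrow> 'n heis \<Rightarrow> 'n heis" where
  "heis_mult (z, t) (w, s) = (z + w, t + s + Im (\<Sum>j\<in>UNIV. z $ j * cnj (w $ j)) / 2)"

fun heis_inv :: "'n::finite heis \<Rightarrow> 'n heis" where
  "heis_inv (z, t) = (- z, - t)"

lemma heis_mult_assoc: "heis_mult (heis_mult x y) u = heis_mult x (heis_mult y u)"
  by (cases x; cases y; cases u)
     (simp add: algebra_simps sum.distrib add_divide_distrib)

lemma heis_mult_zero: "heis_mult x (0, 0) = x" "heis_mult (0, 0) x = x"
  by (cases x; simp)+

lemma heis_inv: "heis_mult (heis_inv x) x = (0, 0)" "heis_mult x (heis_inv x) = (0, 0)"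
  by (cases x; simp add: sum_negf)+

section \<open>Laguerre and Bessel functions\<close>

text \<open>The Rodrigues formula determines the polynomial through its values on \<open>x > 0\<close>; at \<open>x = 0\<close>
  the formula would give \<open>0\<close>, because \<open>0 powr (- \<delta>) = 0\<close>.  See \<open>laguerre_Rodrigues\<close> below.\<close>

definition laguerre_poly :: "nat \<Rightarrow> real \<Rightarrow> real poly" where
  "laguerre_poly k \<delta> = (THE P. \<forall>x>0. poly P x =
     x powr (- \<delta>) * exp x / fact k
       * (deriv ^^ k) (\<lambda>s. exp (- s) * s powr (real k + \<delta>)) x)"

definition laguerre :: "nat \<Rightarrow> real \<Rightarrow> real \<Rightarrow> real" where
  "laguerre k \<delta> x = poly (laguerre_poly k \<delta>) x"

lemma iterated_deriv_exp_powr: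
  "\<exists>P. \<forall>x>0. (deriv ^^ m) (\<lambda>s::real. exp (- s) * s powr a) x
      = exp (- x) * x powr (a - real m) * poly P x"
proof (induction m)
  case 0
  show ?case by (rule exI[of _ 1]) simp
next
  case (Suc m)
  let ?g = "(deriv ^^ m) (\<lambda>s::real. exp (- s) * s powr a)"
  obtain P where P: "\<And>x. x > 0 \<Longrightarrow> ?g x = exp (- x) * x powr (a - real m) * poly P x"
    using Suc.IH by blast
  define R where "R = [:a - real m, -1:] * P + [:0, 1:] * pderiv P"
  have "(deriv ^^ Suc m) (\<lambda>s. exp (- s) * s powr a) x
      = exp (- x) * x powr (a - real (Suc m)) * poly R x" if x: "x > 0" for x
  proof -
    have pw: "x powr (a - real m) = x * x powr (a - real m - 1)"
      using x by (simp add: powr_diff)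
    have "((\<lambda>y. exp (- y) * y powr (a - real m) * poly P y) has_real_derivative
        (exp (- x) * x powr (a - real m - 1) * poly R x)) (at x)"
      unfolding R_def
      by (rule derivative_eq_intros refl x poly_DERIV | simp add: x)+
         (simp add: pw algebra_simps)
    moreover have "eventually (\<lambda>y. y \<in> {0<..}) (nhds x)"
      using x by (intro eventually_nhds_in_open) auto
    then have "eventually (\<lambda>y. ?g y = exp (- y) * y powr (a - real m) * poly P y) (nhds x)"
      by eventually_elim (simp add: P)
    ultimately have "(?g has_real_derivative
        (exp (- x) * x powr (a - real m - 1) * poly R x)) (at x)"
      by (subst DERIV_cong_ev[OF refl _ refl])
    then show ?thesis by (simp add: DERIV_imp_deriv algebra_simps)
  qed
  then show ?case by blast
qed

lemma laguerre_Rodrigues: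
  assumes "x > 0"
  shows "laguerre k \<delta> x = x powr (- \<delta>) * exp x / fact k
    * (deriv ^^ k) (\<lambda>s. exp (- s) * s powr (real k + \<delta>)) x"
proof -
  let ?F = "\<lambda>x. x powr (- \<delta>) * exp x / fact k
    * (deriv ^^ k) (\<lambda>s. exp (- s) * s powr (real k + \<delta>)) x"
  obtain P where P: "\<And>x. x > 0 \<Longrightarrow> (deriv ^^ k) (\<lambda>s. exp (- s) * s powr (real k + \<delta>)) x
      = exp (- x) * x powr \<delta> * poly P x"
    using iterated_deriv_exp_powr[of k "real k + \<delta>"] by auto
  have ex: "\<forall>x>0. poly (smult (1 / fact k) P) x = ?F x"
  proof (intro allI impI)
    fix x :: real assume x: "x > 0"
    have "x powr (- \<delta>) * x powr \<delta> = 1" "exp x * exp (- x) = 1"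
      using x by (simp_all flip: powr_add exp_add)
    then have "x powr (- \<delta>) * exp x * (exp (- x) * x powr \<delta> * poly P x) = poly P x"
      by (metis (no_types, opaque_lifting) mult.assoc mult.commute mult_1)
    then show "poly (smult (1 / fact k) P) x = ?F x"
      by (simp add: P[OF x])
  qed
  have "\<exists>!P. \<forall>x>0. poly P x = ?F x"
  proof (rule ex1I[of _ "smult (1 / fact k) P"], rule ex)
    fix Q assume Q: "\<forall>x>0. poly Q x = ?F x"
    have "infinite {0<..(1::real)}" by (simp add: infinite_Ioc)
    moreover have "{0<..1} \<subseteq> {x. poly (Q - smult (1 / fact k) P) x = 0}"
      using Q ex by auto
    ultimately have "infinite {x. poly (Q - smult (1 / fact k) P) x = 0}"
      using finite_subset by blast
    then show "Q = smult (1 / fact k) P"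
      using poly_roots_finite[of "Q - smult (1 / fact k) P"] by auto
  qed
  from theI'[OF this] assms show ?thesis
    unfolding laguerre_def laguerre_poly_def by blast
qed

definition bessel_J :: "nat \<Rightarrow> real \<Rightarrow> real" where
  "bessel_J m x = (\<Sum>j. (- 1) ^ j / (fact j * fact (j + m)) * (x / 2) ^ (2 * j + m))"

text \<open>\<open>J\<^sub>m(r) / r\<^sup>m\<close>, continuously extended to \<open>r = 0\<close>.\<close>

definition bessel_quot :: "nat \<Rightarrow> real \<Rightarrow> real" where
  "bessel_quot m r = (if r = 0 then 1 / (2 ^ m * fact m) else bessel_J m r / r ^ m)"

section \<open>The Heisenberg fan and its measure\<close>

definition fan_ray :: "nat \<Rightarrow> nat \<Rightarrow> (real \<times> real) set" where
  "fan_ray n k = {(l, real (2 * k + n) * \<bar>l\<bar>) | l. l \<noteq> 0}"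

definition fan_limit_ray :: "(real \<times> real) set" where
  "fan_limit_ray = {(0, \<tau>) | \<tau>. 0 \<le> \<tau>}"

definition heis_fan :: "nat \<Rightarrow> (real \<times> real) set" where
  "heis_fan n = (\<Union>k. fan_ray n k) \<union> fan_limit_ray"

definition ray_index :: "nat \<Rightarrow> real \<times> real \<Rightarrow> nat" where
  "ray_index n a = (THE k. a \<in> fan_ray n k)"

lemma ray_index_eq:
  assumes "l \<noteq> 0"
  shows "ray_index n (l, real (2 * k + n) * \<bar>l\<bar>) = k"
  unfolding ray_index_def fan_ray_def using assms by (intro the_equality) auto

text \<open>Image measure on the fan of \<open>(2\<pi>)\<^sup>-\<^sup>2\<^sup>n\<^sup>-\<^sup>1 ((k+n-1)! / (k! (n-1)!))\<^sup>2 |l|\<^sup>2\<^sup>n dl\<close> on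
  \<open>\<real> \<times> \<nat>\<close>.  The integration formula is \<open>nn_integral_nu2\<close>.\<close>

definition nu2 :: "nat \<Rightarrow> (real \<times> real) measure" where
  "nu2 n = distr
     (density (lborel \<Otimes>\<^sub>M count_space UNIV)
        (\<lambda>(l, k). ennreal ((fact (k + n - 1) / (fact k * fact (n - 1)))\<^sup>2 * \<bar>l\<bar> ^ (2 * n)
                            / (2 * pi) ^ (2 * n + 1))))
     (restrict_space borel (heis_fan n))
     (\<lambda>(l, k). (l, real (2 * k + n) * \<bar>l\<bar>))"

lemma space_nu2: "space (nu2 n) = heis_fan n"
  by (simp add: nu2_def space_restrict_space)

lemma nn_integral_nu2:
  assumes [measurable]: "\<phi> \<in> borel_measurable (restrict_space borel (heis_fan n))"
  shows "(\<integral>\<^sup>+ a. \<phi> a \<partial>nu2 n) =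
    ennreal (1 / (2 * pi) ^ (2 * n + 1)) *
    (\<integral>\<^sup>+ l. (\<Sum>k. ennreal ((fact (k + n - 1) / (fact k * fact (n - 1)))\<^sup>2)
                  * \<phi> (l, real (2 * k + n) * \<bar>l\<bar>)) * ennreal (\<bar>l\<bar> ^ (2 * n)) \<partial>lborel)"
proof -
  interpret C: sigma_finite_measure "count_space (UNIV :: nat set)"
    by (rule sigma_finite_measure_count_space)
  let ?T = "\<lambda>(l::real, k::nat). (l, real (2 * k + n) * \<bar>l\<bar>)"
  let ?c = "\<lambda>k. (fact (k + n - 1) / (fact k * fact (n - 1)) :: real)\<^sup>2"
  let ?K = "1 / (2 * pi) ^ (2 * n + 1) :: real"
  have 1: "?T \<in> lborel \<Otimes>\<^sub>M count_space UNIV \<rightarrow>\<^sub>M restrict_space borel (heis_fan n)"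
  proof (rule measurable_restrict_space2)
    show "?T \<in> space (lborel \<Otimes>\<^sub>M count_space UNIV) \<rightarrow> heis_fan n"
      by (auto simp: heis_fan_def fan_ray_def fan_limit_ray_def)
    show "?T \<in> lborel \<Otimes>\<^sub>M count_space UNIV \<rightarrow>\<^sub>M borel"
      unfolding borel_prod[symmetric] by measurable
  qed
  let ?D = "\<lambda>x::real \<times> nat. ennreal (?c (snd x) * \<bar>fst x\<bar> ^ (2 * n) * ?K)"
  have \<phi>T: "(\<lambda>x. \<phi> (?T x)) \<in> borel_measurable (lborel \<Otimes>\<^sub>M count_space UNIV)"
    by (rule measurable_compose[OF 1 assms])
  have D: "?D \<in> borel_measurable (lborel \<Otimes>\<^sub>M count_space UNIV)"
    by measurable
  have [measurable]: "(\<lambda>l. \<phi> (l, real (2 * k + n) * \<bar>l\<bar>)) \<in> borel_measurable borel" for k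
    using measurable_compose[OF _ \<phi>T, of "\<lambda>l. (l, k)" borel] by simp
  have "(\<integral>\<^sup>+ a. \<phi> a \<partial>nu2 n)
      = (\<integral>\<^sup>+ x. ennreal (?c (snd x) * \<bar>fst x\<bar> ^ (2 * n) * ?K) * \<phi> (?T x)
          \<partial>(lborel \<Otimes>\<^sub>M count_space UNIV))"
  proof -
    have nu2: "nu2 n = distr (density (lborel \<Otimes>\<^sub>M count_space UNIV) ?D)
        (restrict_space borel (heis_fan n)) ?T"
      by (simp add: nu2_def split_beta')
    have "(\<integral>\<^sup>+ a. \<phi> a \<partial>nu2 n)
        = (\<integral>\<^sup>+ x. \<phi> (?T x) \<partial>density (lborel \<Otimes>\<^sub>M count_space UNIV) ?D)"
      unfolding nu2 by (rule nn_integral_distr) (simp_all only: measurable_density_eq1 measurable_distr_eq1 1 assms)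
    also have "\<dots> = (\<integral>\<^sup>+ x. ?D x * \<phi> (?T x) \<partial>(lborel \<Otimes>\<^sub>M count_space UNIV))"
      by (rule nn_integral_density[OF D \<phi>T])
    finally show ?thesis .
  qed
  also have "\<dots> = (\<integral>\<^sup>+ l. \<integral>\<^sup>+ k. ennreal (?c k * \<bar>l\<bar> ^ (2 * n) * ?K)
      * \<phi> (l, real (2 * k + n) * \<bar>l\<bar>) \<partial>count_space UNIV \<partial>lborel)"
    using C.nn_integral_fst[OF borel_measurable_times_ennreal[OF D \<phi>T]]
    by (simp only: fst_conv snd_conv prod.case)
  also have "\<dots> = (\<integral>\<^sup>+ l. ennreal ?K * ((\<Sum>k. ennreal (?c k)
      * \<phi> (l, real (2 * k + n) * \<bar>l\<bar>)) * ennreal (\<bar>l\<bar> ^ (2 * n))) \<partial>lborel)"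
  proof (rule nn_integral_cong)
    fix l :: real
    let ?p = "\<lambda>k. \<phi> (l, real (2 * k + n) * \<bar>l\<bar>)"
    let ?L = "\<bar>l\<bar> ^ (2 * n)"
    have eq: "ennreal (?c k * ?L * ?K) * ?p k
        = ennreal ?K * (ennreal (?c k) * ?p k * ennreal ?L)" for k
    proof -
      have "ennreal (?c k * ?L * ?K) = ennreal (?c k) * ennreal ?L * ennreal ?K"
        by (simp only: ennreal_mult zero_le_power2 zero_le_power abs_ge_zero mult_nonneg_nonneg
              divide_nonneg_nonneg zero_le_one pi_ge_zero zero_le_numeral)
      then show ?thesis by (simp only: mult_ac)
    qed
    show "(\<integral>\<^sup>+ k. ennreal (?c k * ?L * ?K) * ?p k \<partial>count_space UNIV)
        = ennreal ?K * ((\<Sum>k. ennreal (?c k) * ?p k) * ennreal ?L)"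
      unfolding eq nn_integral_count_space_nat ennreal_suminf_cmult ennreal_suminf_multc ..
  qed
  also have "\<dots> = ennreal ?K * (\<integral>\<^sup>+ l. (\<Sum>k. ennreal (?c k)
      * \<phi> (l, real (2 * k + n) * \<bar>l\<bar>)) * ennreal (\<bar>l\<bar> ^ (2 * n)) \<partial>lborel)"
    by (intro nn_integral_cmult) measurable
  finally show ?thesis .
qed

section \<open>The Strichartz Fourier transform\<close>

definition phi_lag :: "nat \<Rightarrow> real \<Rightarrow> complex ^ 'n::finite \<Rightarrow> real" where
  "phi_lag k l z = laguerre k (real CARD('n) - 1) (\<bar>l\<bar> * (norm z)\<^sup>2 / 2)
     * exp (- (\<bar>l\<bar> * (norm z)\<^sup>2 / 4))"

definition e_lag :: "nat \<Rightarrow> real \<Rightarrow> 'n::finite heis \<Rightarrow> complex" where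
  "e_lag k l x = exp (\<i> * of_real (l * snd x)) * of_real (phi_lag k l (fst x))"

text \<open>Only the values on \<^term>\<open>heis_fan CARD('n)\<close> are meaningful; there, \<open>fst a = 0\<close> singles out the limit ray.\<close>

definition strichartz_ft ::
  "('n::finite heis \<Rightarrow> complex) \<Rightarrow> real \<times> real \<Rightarrow> complex ^ 'n \<Rightarrow> complex" where
  "strichartz_ft f a w =
     (if fst a = 0
      then fact (CARD('n) - 1) * 2 ^ (CARD('n) - 1) *
           (LINT x|lborel. f x *
              of_real (bessel_quot (CARD('n) - 1) (sqrt (snd a) * norm (w - fst x))))
      else (LINT x|lborel. f x *
              e_lag (ray_index CARD('n) a) (fst a) (heis_mult (heis_inv x) (w, 0))))"

definition strichartz_ft_normalized ::
  "('n::finite heis \<Rightarrow> complex) \<Rightarrow> real \<times> real \<Rightarrow> complex ^ 'n \<Rightarrow> complex" where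
  "strichartz_ft_normalized f a w =
     (if fst a = 0 then strichartz_ft f a w
      else (let n = CARD('n); k = ray_index n a in
            fact k * fact (n - 1) / fact (k + n - 1) * strichartz_ft f a w))"

section \<open>Weights and norms\<close>

definition v_weight :: "real \<Rightarrow> 'n::finite heis \<Rightarrow> real" where
  "v_weight \<alpha> x = (norm (fst x) ^ 4 + 16 * (snd x)\<^sup>2) powr (\<alpha> / 4)"

text \<open>On the ray with index \<open>k\<close>, \<open>snd a\<close> equals \<open>(2k+n) * \<bar>fst a\<bar>\<close>.\<close>

definition u_weight :: "real \<Rightarrow> real \<Rightarrow> real \<times> real \<Rightarrow> complex ^ 'n::finite \<Rightarrow> real" where
  "u_weight \<sigma> \<rho> a w =
     (if \<bar>fst a\<bar> > 1 \<and> w \<noteq> 0 then snd a powr (- \<sigma>) * norm w powr (- \<rho>) else 0)"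

text \<open>Real powers of possibly infinite integrals, for positive exponents.\<close>

definition ennreal_powr :: "ennreal \<Rightarrow> real \<Rightarrow> ennreal" where
  "ennreal_powr x r = (if x = \<infinity> then \<infinity> else ennreal (enn2real x powr r))"

end

(* Only the first ray k = 0 of the fan is needed, where the transform is an integral against
   exp (i lambda s) exp (- |lambda| |w - z|^2 / 4).  The test functions are L^1-normalised Gaussians g_e adapted to the
   dilations (z, t) -> (e z, e^2 t): expanding the kernel around 1 shows that their transforms are
   bounded below by a positive constant wherever |lambda| (e^2 + |w|^2) is small.
   - A single g_e: its transform is nonzero near w = 0, so |w|^(- rho q) has to be locally integrable.
   - g_e with e -> 0, integrated over 1 < |lambda| < c / e^2 and |w| < e: comparing powers of e (with a
     logarithm in the critical case q sigma = 2 n + 1) gives the three scaling conditions.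
   - F = sum of N dyadic g_e: the transform is of size N, but if alpha p' >= 2 n + 2 then
     F <= D v_alpha^(- p') pointwise, whence F^p v_alpha^p <= D^(p-1) F and the right-hand side is only O(N^(1/p)). *)

theory Submission
  imports Defs "HOL-Probability.Distributions"
begin

section \<open>Polynomials times Gaussians\<close>

text \<open>The condition on \<alpha> expresses local integrability of v^(- p'): formally, f = v^(-
  p') satisfies f^p v^p = f, so both sides diverge with the integral of f, but the right-hand side
  only like its power 1/p. F is a Schwartz substitute for this f: between its smallest and its
  largest scale it behaves like the homogeneous function kor^(- (2 n + 2)), which is v^(- p') at the
  endpoint \<alpha> p' = 2 n + 2, and whose integral grows by a fixed amount per dyadic scale. A
  single g_e compares only powers of e and would miss that endpoint. The case distinction in the
  scaling conditions comes from the cut-off |lambda| > 1 in u. The ray contributes the integral of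
  l^(2 n - q \<sigma>) over 1 < l < B with B of order e^(-2). Its order is set by the upper end, by
  all dyadic blocks alike, or by the lower end, according to whether q \<sigma> is below, equal to
  or above 2 n + 1.\<close>

lemma one_plus_power_exp_bound:
  fixes c :: real
  assumes "c > 0"
  obtains B where "B \<ge> 0" "\<And>r. r \<ge> 0 \<Longrightarrow> (1 + r) ^ k * exp (- (c * r\<^sup>2)) \<le> B"
proof
  let ?B = "(2 / c) ^ k * fact k * exp c"
  show "?B \<ge> 0" using assms by simp
  fix r :: real assume r: "r \<ge> 0"
  \<comment> \<open>The half is chosen so that
    \<open>(1 + r)\<^sup>2 \<le> 2 * (1 + r\<^sup>2)\<close> gives
    \<open>u - c * r\<^sup>2 \<le> c\<close>: the factor \<open>exp u\<close> that bounds the power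
    is absorbed by the Gaussian at the price of \<open>exp c\<close>.\<close>
  define u where "u = c * (1 + r)\<^sup>2 / 2"
  have u: "u \<ge> 0" using assms by (simp add: u_def)
  have "u ^ k / fact k \<le> exp u"
  proof -
    have "(\<Sum>i\<in>{k}. u ^ i / fact i) \<le> (\<Sum>i. u ^ i / fact i)"
      using u summable_exp_generic[of u] by (intro sum_le_suminf) (auto simp: divide_inverse_commute)
    then show ?thesis by (simp add: exp_def divide_inverse_commute)
  qed
  then have "u ^ k \<le> fact k * exp u" by (simp add: field_simps)
  have "(1 + r) ^ k \<le> ((1 + r)\<^sup>2) ^ k"
    using r by (intro power_mono) (auto simp: power2_eq_square algebra_simps)
  also have "\<dots> = (2 / c) ^ k * u ^ k"
    using assms by (simp add: u_def flip: power_mult_distrib)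
  also have "\<dots> \<le> (2 / c) ^ k * (fact k * exp u)"
    using \<open>u ^ k \<le> _\<close> assms by (intro mult_left_mono) auto
  finally have "(1 + r) ^ k * exp (- (c * r\<^sup>2)) \<le> (2 / c) ^ k * fact k * exp (u - c * r\<^sup>2)"
    by (simp add: exp_diff exp_minus field_simps)
  also have "u - c * r\<^sup>2 \<le> c"
  proof -
    have "(1 + r)\<^sup>2 \<le> 2 * (1 + r\<^sup>2)"
      using sum_squares_ge_zero[of "1 - r" 0] by (simp add: power2_eq_square algebra_simps)
    then have "c * (1 + r)\<^sup>2 \<le> c * (2 * (1 + r\<^sup>2))"
      using assms by (intro mult_left_mono) auto
    then show ?thesis by (simp add: u_def algebra_simps)
  qed
  finally show "(1 + r) ^ k * exp (- (c * r\<^sup>2)) \<le> ?B"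
    using assms by simp
qed

lemma real_polynomial_function_growth:
  assumes "real_polynomial_function p"
  shows "\<exists>C m. C \<ge> 0 \<and> (\<forall>x. \<bar>p x\<bar> \<le> C * (1 + norm x) ^ m)"
  using assms
proof induction
  case (linear f)
  from bounded_linear.pos_bounded[OF linear] obtain K where "K > 0" "\<And>x. norm (f x) \<le> norm x * K"
    by blast
  then have "\<bar>f x\<bar> \<le> K * (1 + norm x) ^ 1" for x
    using \<open>K > 0\<close> by (simp add: algebra_simps add_increasing)
  then have "K \<ge> 0 \<and> (\<forall>x. \<bar>f x\<bar> \<le> K * (1 + norm x) ^ 1)"
    using \<open>K > 0\<close> by simp
  then show ?case by blast
next
  case (const c)
  have "\<bar>c\<bar> \<ge> 0 \<and> (\<forall>x::'a. \<bar>c\<bar> \<le> \<bar>c\<bar> * (1 + norm x) ^ 0)" by simp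
  then show ?case by blast
next
  case (add f g)
  then obtain C m D l where *: "C \<ge> 0" "\<And>x. \<bar>f x\<bar> \<le> C * (1 + norm x) ^ m"
    "D \<ge> 0" "\<And>x. \<bar>g x\<bar> \<le> D * (1 + norm x) ^ l" by blast
  have "\<bar>f x + g x\<bar> \<le> (C + D) * (1 + norm x) ^ (m + l)" for x
  proof -
    have "C * (1 + norm x) ^ m \<le> C * (1 + norm x) ^ (m + l)"
      "D * (1 + norm x) ^ l \<le> D * (1 + norm x) ^ (m + l)"
      using * by (auto intro!: mult_left_mono power_increasing)
    then show ?thesis using *(2,4)[of x] by (simp add: algebra_simps)
  qed
  then show ?case using *(1,3) by (intro exI[of _ "C + D"] exI[of _ "m + l"]) auto
next
  case (mult f g)
  then obtain C m D l where *: "C \<ge> 0" "\<And>x. \<bar>f x\<bar> \<le> C * (1 + norm x) ^ m"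
    "D \<ge> 0" "\<And>x. \<bar>g x\<bar> \<le> D * (1 + norm x) ^ l" by blast
  have "\<bar>f x * g x\<bar> \<le> (C * D) * (1 + norm x) ^ (m + l)" for x
    using mult_mono[OF *(2)[of x] *(4)[of x]] * by (simp add: abs_mult power_add algebra_simps)
  then show ?case using *(1,3) by (intro exI[of _ "C * D"] exI[of _ "m + l"]) auto
qed

text \<open>\<open>iter_deriv\<close> evaluates each derivative in a fixed direction, so polynomial
  dependence on \<open>x\<close> is claimed for every \<open>v\<close> separately.\<close>

lemma real_polynomial_function_derivative:
  assumes "real_polynomial_function p"
  shows "\<exists>p'. (\<forall>v. real_polynomial_function (\<lambda>x. p' x v)) \<and> (\<forall>x. (p has_derivative p' x) (at x))"
  using assms
proof induction
  case (linear f)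
  then show ?case
    by (intro exI[of _ "\<lambda>x. f"]) (auto intro: bounded_linear_imp_has_derivative)
next
  case (const c)
  then show ?case by (intro exI[of _ "\<lambda>x v. 0"]) auto
next
  case (add f g)
  then obtain f' g' where *: "\<And>v. real_polynomial_function (\<lambda>x. f' x v)"
    "\<And>v. real_polynomial_function (\<lambda>x. g' x v)"
    "\<And>x. (f has_derivative f' x) (at x)" "\<And>x. (g has_derivative g' x) (at x)" by blast
  then show ?case
    by (intro exI[of _ "\<lambda>x v. f' x v + g' x v"]) (auto intro!: has_derivative_add)
next
  case (mult f g)
  then obtain f' g' where *: "\<And>v. real_polynomial_function (\<lambda>x. f' x v)"
    "\<And>v. real_polynomial_function (\<lambda>x. g' x v)"
    "\<And>x. (f has_derivative f' x) (at x)" "\<And>x. (g has_derivative g' x) (at x)" by blast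
  then show ?case using mult.hyps
    by (intro exI[of _ "\<lambda>x v. f x * g' x v + f' x v * g x"]) (intro conjI allI has_derivative_mult real_polynomial_function.intros(3,4) *
        mult.hyps)
qed

lemma real_polynomial_function_times_gaussian_derivative:
  assumes "real_polynomial_function P" "real_polynomial_function Q"
  shows "\<exists>R. (\<forall>v. real_polynomial_function (\<lambda>x. R x v)) \<and>
    (\<forall>x. ((\<lambda>x. complex_of_real (P x * exp (- Q x))) has_derivative
            (\<lambda>v. complex_of_real (R x v * exp (- Q x)))) (at x))"
proof -
  obtain P' where P': "\<And>v. real_polynomial_function (\<lambda>x. P' x v)"
    "\<And>x. (P has_derivative P' x) (at x)"
    using real_polynomial_function_derivative[OF assms(1)] by blast
  obtain Q' where Q': "\<And>v. real_polynomial_function (\<lambda>x. Q' x v)"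
    "\<And>x. (Q has_derivative Q' x) (at x)"
    using real_polynomial_function_derivative[OF assms(2)] by blast
  have "((\<lambda>x. complex_of_real (P x * exp (- Q x))) has_derivative
            (\<lambda>v. complex_of_real ((P' x v + (- 1) * (P x * Q' x v)) * exp (- Q x)))) (at x)" for x
  proof (rule has_derivative_of_real)
    have "((\<lambda>x. exp (- Q x)) has_derivative (\<lambda>v. exp (- Q x) * (- Q' x v))) (at x)"
      using has_derivative_exp[OF has_derivative_minus[OF Q'(2)]] by (simp add: mult.commute)
    from has_derivative_mult[OF P'(2) this]
    show "((\<lambda>x. P x * exp (- Q x)) has_derivative
            (\<lambda>v. (P' x v + (- 1) * (P x * Q' x v)) * exp (- Q x))) (at x)"
      by (rule has_derivative_eq_rhs) (simp add: fun_eq_iff algebra_simps)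
  qed
  moreover have "real_polynomial_function (\<lambda>x. P' x v + (- 1) * (P x * Q' x v))" for v
  proof -
    note rpf = real_polynomial_function.intros
    have "real_polynomial_function (\<lambda>x. P x * Q' x v)"
      using rpf(4)[of P "\<lambda>x. Q' x v"] assms(1) Q'(1)[of v] by simp
    then have "real_polynomial_function (\<lambda>x. (- 1) * (P x * Q' x v))"
      using rpf(4)[of "\<lambda>x. - 1" "\<lambda>x. P x * Q' x v"] rpf(2)[of "- 1"] by blast
    then show ?thesis
      using rpf(3)[of "\<lambda>x. P' x v" "\<lambda>x. (- 1) * (P x * Q' x v)"] P'(1)[of v] by blast
  qed
  ultimately show ?thesis
    by (intro exI[of _ "\<lambda>x v. P' x v + (- 1) * (P x * Q' x v)"] conjI allI)
qed

text \<open>For a fixed \<open>Q\<close> the products of a polynomial with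
  \<open>exp (- Q x)\<close> are closed under directional derivatives, the new factor being P' - P
  Q'. All iterated derivatives thus have one shape, and a single decay estimate serves them
  all.\<close>

lemma iter_deriv_times_gaussian:
  assumes "real_polynomial_function P" "real_polynomial_function Q"
  shows "\<exists>R. real_polynomial_function R \<and>
    iter_deriv (\<lambda>x. complex_of_real (P x * exp (- Q x))) vs = (\<lambda>x. complex_of_real (R x * exp (- Q x)))"
proof (induction vs)
  case Nil
  then show ?case using assms by auto
next
  case (Cons v vs)
  then obtain R where R: "real_polynomial_function R"
    "iter_deriv (\<lambda>x. complex_of_real (P x * exp (- Q x))) vs = (\<lambda>x. complex_of_real (R x * exp (- Q x)))"
    by blast
  obtain S where S: "\<And>v. real_polynomial_function (\<lambda>x. S x v)"
    "\<And>x. ((\<lambda>x. complex_of_real (R x * exp (- Q x))) has_derivative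
            (\<lambda>v. complex_of_real (S x v * exp (- Q x)))) (at x)"
    using real_polynomial_function_times_gaussian_derivative[OF R(1) assms(2)] by blast
  show ?case
    unfolding iter_deriv.simps R(2) frechet_derivative_at[OF S(2), symmetric]
    using S(1)[of v] by blast
qed

lemma schwartz_polynomial_times_gaussian:
  fixes P Q :: "'a::euclidean_space \<Rightarrow> real"
  assumes "real_polynomial_function P" "real_polynomial_function Q"
    and c: "c > 0" "\<And>x. Q x \<ge> c * (norm x)\<^sup>2"
  shows "schwartz (\<lambda>x. complex_of_real (P x * exp (- Q x)))"
  unfolding schwartz_def
proof (intro ballI conjI allI)
  fix vs :: "'a list"
  let ?f = "\<lambda>x. complex_of_real (P x * exp (- Q x))"
  obtain R where R: "real_polynomial_function R"
    "iter_deriv ?f vs = (\<lambda>x. complex_of_real (R x * exp (- Q x)))"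
    using iter_deriv_times_gaussian[OF assms(1,2)] by blast
  show "iter_deriv ?f vs differentiable at x" for x
    using real_polynomial_function_times_gaussian_derivative[OF R(1) assms(2)]
    unfolding R(2) differentiable_def by blast
  fix N
  obtain C m where C: "C \<ge> 0" "\<And>x. \<bar>R x\<bar> \<le> C * (1 + norm x) ^ m"
    using real_polynomial_function_growth[OF R(1)] by blast
  obtain B where B: "B \<ge> 0" "\<And>r. r \<ge> 0 \<Longrightarrow> (1 + r) ^ (N + m) * exp (- (c * r\<^sup>2)) \<le> B"
    using one_plus_power_exp_bound[OF c(1)] by blast
  have "norm x ^ N * norm (iter_deriv ?f vs x) \<le> C * B" for x
  proof -
    have "norm x ^ N * norm (iter_deriv ?f vs x) = norm x ^ N * (\<bar>R x\<bar> * exp (- Q x))"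
      by (simp only: R(2) norm_of_real abs_mult abs_exp_cancel)
    also have "\<dots> \<le> (1 + norm x) ^ N * ((C * (1 + norm x) ^ m) * exp (- (c * (norm x)\<^sup>2)))"
      using C c by (intro mult_mono power_mono) auto
    also have "\<dots> = C * ((1 + norm x) ^ (N + m) * exp (- (c * (norm x)\<^sup>2)))"
      by (simp add: power_add)
    also have "\<dots> \<le> C * B" using C B(2)[of "norm x"] by (intro mult_left_mono) auto
    finally show ?thesis .
  qed
  then show "\<exists>B. \<forall>x. norm x ^ N * norm (iter_deriv ?f vs x) \<le> B" by blast
qed

section \<open>Finite sums of Schwartz functions\<close>

lemma schwartz_add:
  assumes "schwartz f" "schwartz g"
  shows "schwartz (\<lambda>x. f x + g x)"
proof -
  \<comment> \<open>\<open>frechet_derivative\<close> is a choice and is additive only where both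
    derivatives exist. Lists over \<open>Basis\<close> are exactly those for which
    \<open>schwartz\<close> provides differentiability.\<close>
  have eq: "iter_deriv (\<lambda>x. f x + g x) vs = (\<lambda>x. iter_deriv f vs x + iter_deriv g vs x)"
    if "vs \<in> lists Basis" for vs
    using that
  proof (induction vs)
    case (Cons v vs)
    have "frechet_derivative (\<lambda>x. iter_deriv f vs x + iter_deriv g vs x) (at x) =
      (\<lambda>v. frechet_derivative (iter_deriv f vs) (at x) v + frechet_derivative (iter_deriv g vs) (at x) v)" for x
    proof (rule frechet_derivative_at[symmetric], rule has_derivative_add)
      show "(iter_deriv f vs has_derivative frechet_derivative (iter_deriv f vs) (at x)) (at x)"
        "(iter_deriv g vs has_derivative frechet_derivative (iter_deriv g vs) (at x)) (at x)"
        using assms Cons by (auto simp: schwartz_def frechet_derivative_works)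
    qed
    with Cons show ?case by simp
  qed simp
  show ?thesis
    unfolding schwartz_def
  proof (intro ballI conjI allI)
    fix vs :: "'a list" assume vs: "vs \<in> lists Basis"
    show "iter_deriv (\<lambda>x. f x + g x) vs differentiable at x" for x
      using assms vs unfolding eq[OF vs] schwartz_def by (intro differentiable_add) auto
    fix N
    obtain B D where B: "\<And>x. norm x ^ N * norm (iter_deriv f vs x) \<le> B"
      "\<And>x. norm x ^ N * norm (iter_deriv g vs x) \<le> D"
      using assms vs unfolding schwartz_def by metis
    have "norm x ^ N * norm (iter_deriv f vs x + iter_deriv g vs x) \<le> B + D" for x
      using mult_left_mono[OF norm_triangle_ineq[of "iter_deriv f vs x" "iter_deriv g vs x"], of "norm x ^ N"]
        B[of x] by (simp add: distrib_left)
    then show "\<exists>B. \<forall>x. norm x ^ N * norm (iter_deriv (\<lambda>x. f x + g x) vs x) \<le> B"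
      unfolding eq[OF vs] by blast
  qed
qed

lemma iter_deriv_zero: "iter_deriv (\<lambda>x. 0) vs = (\<lambda>x. 0)"
  by (induction vs) (auto simp: frechet_derivative_const)

lemma schwartz_sum:
  assumes "finite J" "\<And>j. j \<in> J \<Longrightarrow> schwartz (f j)"
  shows "schwartz (\<lambda>x. \<Sum>j\<in>J. f j x)"
  using assms
proof (induction J)
  case empty
  then show ?case by (auto simp: schwartz_def iter_deriv_zero)
next
  case (insert j J)
  then show ?case by (simp add: schwartz_add)
qed

section \<open>Integrability under Gaussian bounds\<close>

lemma nn_integral_gaussian_finite:
  "(\<integral>\<^sup>+ (x::'a::euclidean_space). ennreal (exp (- (norm x)\<^sup>2 / 2)) \<partial>lborel) < \<infinity>"
proof -
  have 1: "(\<integral>\<^sup>+ (x::real). ennreal (exp (- x\<^sup>2 / 2)) \<partial>lborel) < \<infinity>"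
  proof -
    have "integrable lborel (\<lambda>x. sqrt (2 * pi) * std_normal_density x)"
      by (intro integrable_mult_right) simp
    then have "integrable lborel (\<lambda>x::real. exp (- x\<^sup>2 / 2))"
      by (rule Bochner_Integration.integrable_cong[THEN iffD1, rotated -1])
         (auto simp: std_normal_density_def)
    then show ?thesis by (simp add: integrable_iff_bounded)
  qed
  \<comment> \<open>The Gaussian splits over the coordinates, and each factor is a multiple of the
    standard normal density.\<close>
  have "exp (- (norm x)\<^sup>2 / 2) = (\<Prod>b\<in>Basis. exp (- (x \<bullet> b)\<^sup>2 / 2))" for x :: 'a
    by (simp add: exp_sum[symmetric] sum_negf sum_divide_distrib[symmetric] power2_norm_eq_inner
        euclidean_inner[of x x]) (simp add: power2_eq_square)
  then have "(\<integral>\<^sup>+ (x::'a). ennreal (exp (- (norm x)\<^sup>2 / 2)) \<partial>lborel) =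
    (\<integral>\<^sup>+ (x::'a). (\<Prod>b\<in>Basis. ennreal (exp (- (x \<bullet> b)\<^sup>2 / 2))) \<partial>lborel)"
    by (simp add: prod_ennreal)
  also have "\<dots> = (\<Prod>b\<in>(Basis::'a set). \<integral>\<^sup>+ (x::real). ennreal (exp (- x\<^sup>2 / 2)) \<partial>lborel)"
    by (rule nn_integral_lborel_prod) auto
  also have "\<dots> < \<infinity>"
    using 1 by (simp add: power_less_top_ennreal)
  finally show ?thesis .
qed

text \<open>One half of the exponent absorbs the polynomial factor, the other half is the integrable
  Gaussian of the preceding lemma.\<close>

lemma integrable_poly_gaussian:
  fixes f :: "'a::euclidean_space \<Rightarrow> 'b::{banach, second_countable_topology}"
  assumes "f \<in> borel_measurable borel" and f: "\<And>x. norm (f x) \<le> C * (1 + norm x) ^ k * exp (- (norm x)\<^sup>2)"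
  shows "integrable lborel f"
proof (rule integrableI_bounded)
  show "f \<in> borel_measurable lborel" using assms by simp
  obtain B where B: "B \<ge> 0" "\<And>r::real. r \<ge> 0 \<Longrightarrow> (1 + r) ^ k * exp (- (1 / 2 * r\<^sup>2)) \<le> B"
    using one_plus_power_exp_bound[of "1/2"] by auto
  have "norm (f x) \<le> \<bar>C\<bar> * B * exp (- (norm x)\<^sup>2 / 2)" for x
  proof -
    have "exp (- (norm x)\<^sup>2) = exp (- (1 / 2 * (norm x)\<^sup>2)) * exp (- (norm x)\<^sup>2 / 2)"
      by (simp flip: exp_add)
    then have "norm (f x) \<le> C * ((1 + norm x) ^ k * exp (- (1 / 2 * (norm x)\<^sup>2))) * exp (- (norm x)\<^sup>2 / 2)"
      using f[of x] by (simp add: algebra_simps)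
    also have "\<dots> \<le> \<bar>C\<bar> * B * exp (- (norm x)\<^sup>2 / 2)"
      using B(2)[of "norm x"] by (intro mult_right_mono mult_mono) auto
    finally show ?thesis .
  qed
  then have "(\<integral>\<^sup>+ x. ennreal (norm (f x)) \<partial>lborel) \<le>
      (\<integral>\<^sup>+ (x::'a). ennreal (\<bar>C\<bar> * B) * ennreal (exp (- (norm x)\<^sup>2 / 2)) \<partial>lborel)"
    using B(1) by (intro nn_integral_mono) (simp flip: ennreal_mult)
  also have "\<dots> = ennreal (\<bar>C\<bar> * B) * (\<integral>\<^sup>+ (x::'a). ennreal (exp (- (norm x)\<^sup>2 / 2)) \<partial>lborel)"
    by (rule nn_integral_cmult) simp
  also have "\<dots> < \<infinity>"
    using nn_integral_gaussian_finite by (auto simp: ennreal_mult_less_top)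
  finally show "(\<integral>\<^sup>+ x. ennreal (norm (f x)) \<partial>lborel) < \<infinity>" .
qed

section \<open>Dilations\<close>

definition dil :: "real \<Rightarrow> 'n::finite heis \<Rightarrow> 'n heis" where
  "dil e x = (e *\<^sub>R fst x, e\<^sup>2 *\<^sub>R snd x)"

text \<open>The homogeneous dimension: the horizontal directions contribute 2 n to the Jacobian
  exponent of \<open>dil e\<close>, and the centre contributes 2.\<close>

abbreviation hdim :: "'n::finite itself \<Rightarrow> nat" where
  "hdim _ \<equiv> 2 * CARD('n) + 2"

lemma fst_dil [simp]: "fst (dil e x) = e *\<^sub>R fst x"
  and snd_dil [simp]: "snd (dil e x) = e\<^sup>2 * snd x"
  by (simp_all add: dil_def)

lemma lborel_dil:
  fixes e :: real
  assumes "e > 0"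
  shows "(lborel :: 'n::finite heis measure) =
    density (distr lborel borel (dil e)) (\<lambda>_. ennreal (e ^ hdim TYPE('n)))"
proof -
  \<comment> \<open>Only the basis vector \<open>(0, 1)\<close> has a nonzero second component; it
    spans the centre, which is scaled by the square of \<open>e\<close>.\<close>
  let ?c = "\<lambda>j :: 'n heis. if snd j = 0 then e else e\<^sup>2"
  have B: "(Basis :: 'n heis set) = (\<lambda>u. (u, 0)) ` Basis \<union> {(0, 1)}"
    by (simp add: Basis_prod_def)
  have disj: "(\<lambda>u. (u, 0)) ` Basis \<inter> {(0 :: complex ^ 'n, 1 :: real)} = {}"
    by auto
  have inj: "inj_on (\<lambda>u :: complex ^ 'n. (u, 0 :: real)) Basis"
    by (auto simp: inj_on_def)
  have "(\<Sum>j\<in>Basis. (?c j * (x \<bullet> j)) *\<^sub>R j) = dil e x" for x :: "'n heis"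
    unfolding B
    by (subst sum.union_disjoint[OF _ _ disj])
       (auto simp: sum.reindex[OF inj] dil_def prod_eq_iff inner_prod_def fst_sum snd_sum
          scaleR_sum_right[symmetric] scaleR_scaleR[symmetric] euclidean_representation
        simp del: scaleR_scaleR)
  moreover have "(\<Prod>j\<in>Basis. \<bar>?c j\<bar>) = e ^ hdim TYPE('n)"
    unfolding B using assms
    by (subst prod.union_disjoint[OF _ _ disj])
       (auto simp: prod.reindex[OF inj] power_add power2_eq_square mult.commute)
  ultimately show ?thesis
    using lborel_affine_euclidean[of ?c "0 :: 'n heis"] assms by simp
qed

lemma continuous_on_dil: "continuous_on UNIV (dil e)"
  unfolding dil_def by (intro continuous_intros)

lemma measurable_dil [measurable]: "dil e \<in> borel_measurable borel"
  by (intro borel_measurable_continuous_onI continuous_on_dil)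

lemma nn_integral_dil:
  fixes f :: "'n::finite heis \<Rightarrow> ennreal"
  assumes "e > 0" and [measurable]: "f \<in> borel_measurable borel"
  shows "(\<integral>\<^sup>+ x. f x \<partial>lborel) = ennreal (e ^ hdim TYPE('n)) * (\<integral>\<^sup>+ x. f (dil e x) \<partial>lborel)"
  by (subst lborel_dil[OF assms(1)])
     (simp add: nn_integral_density nn_integral_distr nn_integral_cmult)

lemma integrable_dil_iff:
  fixes f :: "'n::finite heis \<Rightarrow> 'b::{banach, second_countable_topology}"
  assumes "e > 0" and [measurable]: "f \<in> borel_measurable borel"
  shows "integrable lborel f \<longleftrightarrow> integrable lborel (\<lambda>x. f (dil e x))"
proof -
  define c where "c = e ^ hdim TYPE('n)"
  have "c > 0" using assms(1) by (simp add: c_def)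
  have "integrable lborel f \<longleftrightarrow> integrable lborel (\<lambda>x. c *\<^sub>R f (dil e x))"
    using assms(1) unfolding c_def by (subst lborel_dil[OF assms(1)]) (simp add: integrable_density integrable_distr_eq)
  also have "\<dots> \<longleftrightarrow> integrable lborel (\<lambda>x. f (dil e x))"
    using \<open>c > 0\<close> integrable_scaleR_right[of c lborel "\<lambda>x. f (dil e x)"]
      integrable_scaleR_right[of "inverse c" lborel "\<lambda>x. c *\<^sub>R f (dil e x)"] by auto
  finally show ?thesis .
qed

lemma integral_dil:
  fixes f :: "'n::finite heis \<Rightarrow> 'b::{banach, second_countable_topology}"
  assumes "e > 0" and [measurable]: "f \<in> borel_measurable borel"
  shows "(LINT x|lborel. f x) = e ^ hdim TYPE('n) *\<^sub>R (LINT x|lborel. f (dil e x))"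
  using assms(1)
  by (subst lborel_dil[OF assms(1)])
     (simp add: integral_density integral_distr)

section \<open>The Koranyi gauge, homogeneous of degree one under dilations\<close>

definition kor :: "'n::finite heis \<Rightarrow> real" where
  "kor x = (norm (fst x) ^ 4 + 16 * (snd x)\<^sup>2) powr (1 / 4)"

lemma kor_nonneg [simp]: "kor x \<ge> 0"
  by (simp add: kor_def)

lemma kor_pos_iff: "kor x > 0 \<longleftrightarrow> x \<noteq> 0"
proof -
  have "norm (fst x) ^ 4 + 16 * (snd x)\<^sup>2 = 0 \<longleftrightarrow> x = 0"
    by (auto simp: add_nonneg_eq_0_iff prod_eq_iff)
  then show ?thesis by (auto simp: kor_def)
qed

lemma v_weight_eq: "v_weight \<alpha> x = kor x powr \<alpha>"
  by (simp add: v_weight_def kor_def powr_powr)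

lemma kor_power4: "kor x ^ 4 = norm (fst x) ^ 4 + 16 * (snd x)\<^sup>2"
proof (cases "x = 0")
  case False
  then have "norm (fst x) ^ 4 + 16 * (snd x)\<^sup>2 > 0"
    using kor_pos_iff[of x] by (auto simp: kor_def less_le)
  then show ?thesis by (simp add: kor_def powr_powr flip: powr_realpow)
qed (simp add: kor_def)

lemma kor_dil:
  assumes "e \<ge> 0"
  shows "kor (dil e x) = e * kor x"
proof (rule power_eq_imp_eq_base)
  show "kor (dil e x) ^ 4 = (e * kor x) ^ 4"
    by (simp add: kor_power4 power_mult_distrib power_mult[symmetric] algebra_simps)
qed (use assms in auto)

lemma continuous_on_kor: "continuous_on UNIV (kor :: 'n::finite heis \<Rightarrow> real)"
  unfolding kor_def by (intro continuous_on_powr' continuous_intros) auto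

lemma measurable_kor [measurable]: "kor \<in> borel_measurable borel"
  by (intro borel_measurable_continuous_onI continuous_on_kor)

text \<open>The gauge and the Euclidean norm scale differently. This linear bound transfers powers
  of the gauge to powers of \<open>1 + norm x\<close>, which a Gaussian controls.\<close>

lemma kor_le: "kor x \<le> 3 * (1 + norm x)"
proof (rule power_le_imp_le_base)
  have n: "(norm x)\<^sup>2 = (norm (fst x))\<^sup>2 + (snd x)\<^sup>2"
    by (simp add: norm_prod_def)
  \<comment> \<open>The 8 is half of the 16 in the gauge: the cross term of the square supplies
    \<open>16 * (snd x)\<^sup>2\<close>.\<close>
  have "kor x ^ 4 \<le> ((norm x)\<^sup>2 + 8)\<^sup>2"
  proof -
    have "((norm x)\<^sup>2 + 8)\<^sup>2 = ((norm (fst x))\<^sup>2)\<^sup>2 + 16 * (snd x)\<^sup>2 +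
        (64 + 16 * (norm (fst x))\<^sup>2 + ((snd x)\<^sup>2)\<^sup>2 + 2 * ((norm (fst x))\<^sup>2 * (snd x)\<^sup>2))"
      unfolding n by (simp add: power2_eq_square algebra_simps)
    moreover have "((norm (fst x))\<^sup>2)\<^sup>2 = norm (fst x) ^ 4"
      by (simp flip: power_mult)
    ultimately show ?thesis by (simp add: kor_power4)
  qed
  also have "\<dots> \<le> ((3 * (1 + norm x))\<^sup>2)\<^sup>2"
  proof (rule power_mono)
    have "0 \<le> (norm x)\<^sup>2 * 8 + 18 * norm x + 1" by simp
    then show "(norm x)\<^sup>2 + 8 \<le> (3 * (1 + norm x))\<^sup>2"
      by (simp add: power2_eq_square algebra_simps)
  qed auto
  also have "\<dots> = (3 * (1 + norm x)) ^ Suc 3"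
    by (simp flip: power_mult)
  finally show "kor x ^ Suc 3 \<le> (3 * (1 + norm x)) ^ Suc 3" by (simp add: numeral_eq_Suc)
qed simp

section \<open>Dilated Gaussians\<close>

text \<open>The central variable has weight two, hence the fourth power of \<open>e\<close> below
  its square. The prefactor makes the integral independent of \<open>e\<close>; its value is
  \<open>gauss_mass\<close>, not 1.\<close>

definition hgauss :: "real \<Rightarrow> 'n::finite heis \<Rightarrow> real" where
  "hgauss e x = exp (- ((norm (fst x))\<^sup>2 / e\<^sup>2 + (snd x)\<^sup>2 / e ^ 4)) / e ^ hdim TYPE('n)"

lemma hgauss_nonneg: "e > 0 \<Longrightarrow> hgauss e x \<ge> 0"
  by (simp add: hgauss_def)

lemma hgauss_dil:
  assumes "e > 0"
  shows "e ^ hdim TYPE('n) * hgauss e (dil e x) = exp (- (norm (x :: 'n::finite heis))\<^sup>2)"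
proof -
  have "(norm (fst (dil e x)))\<^sup>2 / e\<^sup>2 + (snd (dil e x))\<^sup>2 / e ^ 4 = (norm x)\<^sup>2"
    using assms by (simp add: norm_prod_def power_mult_distrib flip: power_mult)
  then show ?thesis using assms by (simp add: hgauss_def)
qed

lemma measurable_hgauss [measurable]: "hgauss e \<in> borel_measurable borel"
  unfolding hgauss_def divide_inverse by (intro borel_measurable_continuous_onI continuous_intros)

lemma schwartz_hgauss:
  assumes "e > 0"
  shows "schwartz (\<lambda>x :: 'n::finite heis. complex_of_real (hgauss e x))"
proof -
  have norm2: "(norm (fst x))\<^sup>2 = (\<Sum>b\<in>Basis. (fst x \<bullet> b) * (fst x \<bullet> b))" for x :: "'n heis"
    by (simp add: power2_norm_eq_inner euclidean_inner[symmetric])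
  have Q: "real_polynomial_function (\<lambda>x :: 'n heis. (norm (fst x))\<^sup>2 / e\<^sup>2 + (snd x)\<^sup>2 / e ^ 4)"
    unfolding norm2 power2_eq_square[of "snd _"] divide_inverse
    by (intro real_polynomial_function.intros real_polynomial_function_sum finite_Basis
        bounded_linear_snd bounded_linear_compose[OF bounded_linear_inner_left] bounded_linear_fst)
  have P: "real_polynomial_function (\<lambda>x :: 'n heis. 1 / e ^ hdim TYPE('n))" by (rule real_polynomial_function.intros)
  have "schwartz (\<lambda>x :: 'n heis. complex_of_real ((1 / e ^ hdim TYPE('n)) *
      exp (- ((norm (fst x))\<^sup>2 / e\<^sup>2 + (snd x)\<^sup>2 / e ^ 4))))"
  proof (rule schwartz_polynomial_times_gaussian[OF P Q])
    let ?c = "min (1 / e\<^sup>2) (1 / e ^ 4)"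
    show "?c > 0" using assms by simp
    fix x :: "'n heis"
    have "?c * (norm x)\<^sup>2 = ?c * (norm (fst x))\<^sup>2 + ?c * (snd x)\<^sup>2"
      by (simp add: norm_prod_def distrib_left)
    also have "\<dots> \<le> 1 / e\<^sup>2 * (norm (fst x))\<^sup>2 + 1 / e ^ 4 * (snd x)\<^sup>2"
      by (intro add_mono mult_right_mono) auto
    finally show "?c * (norm x)\<^sup>2 \<le> (norm (fst x))\<^sup>2 / e\<^sup>2 + (snd x)\<^sup>2 / e ^ 4" by simp
  qed
  then show ?thesis by (simp add: hgauss_def)
qed

section \<open>The transform on the first ray\<close>

text \<open>The Rodrigues formula speaks about \<open>x > 0\<close> only. Agreement of two
  polynomials on an interval extends it to all \<open>x\<close>, including the value at 0 that
  occurs for w = z.\<close>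

lemma laguerre_0: "laguerre 0 \<delta> x = 1"
proof -
  have "{0<..(1::real)} \<subseteq> {x. poly (laguerre_poly 0 \<delta> - 1) x = 0}"
    using laguerre_Rodrigues[of _ 0 \<delta>] by (auto simp: laguerre_def powr_minus exp_minus field_simps)
  moreover have "infinite {0<..(1::real)}" by (simp add: infinite_Ioc)
  ultimately have "infinite {x. poly (laguerre_poly 0 \<delta> - 1) x = 0}"
    using finite_subset by blast
  then have "laguerre_poly 0 \<delta> - 1 = 0"
    using poly_roots_finite by blast
  then show ?thesis by (simp add: laguerre_def)
qed

lemma e_lag_0: "e_lag 0 l x = exp (\<i> * of_real (l * snd x)) * of_real (exp (- (\<bar>l\<bar> * (norm (fst x))\<^sup>2 / 4)))"
  by (simp add: e_lag_def phi_lag_def laguerre_0)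

lemma heis_mult_inv: "heis_mult (heis_inv x) (w, 0) =
    (w - fst x, - snd x - Im (\<Sum>j\<in>UNIV. fst x $ j * cnj (w $ j)) / 2)"
  by (cases x) (simp add: sum_negf)

lemma Im_hermitian_le:
  fixes z w :: "complex ^ 'n::finite"
  shows "\<bar>Im (\<Sum>j\<in>UNIV. z $ j * cnj (w $ j))\<bar> \<le> norm z * norm w"
proof -
  have "\<bar>Im (\<Sum>j\<in>UNIV. z $ j * cnj (w $ j))\<bar> \<le> norm (\<Sum>j\<in>UNIV. z $ j * cnj (w $ j))"
    by (rule abs_Im_le_cmod)
  also have "\<dots> \<le> (\<Sum>j\<in>UNIV. \<bar>norm (z $ j)\<bar> * \<bar>norm (w $ j)\<bar>)"
    by (rule order_trans[OF norm_sum]) (simp add: norm_mult)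
  also have "\<dots> \<le> norm z * norm w"
    unfolding norm_vec_def by (rule L2_set_mult_ineq)
  finally show ?thesis .
qed

lemma exp_times_cos_lower:
  fixes a \<theta> :: real
  assumes "a \<ge> 0"
  shows "1 - a - \<bar>\<theta>\<bar> \<le> exp (- a) * cos \<theta>"
proof -
  have "1 - cos \<theta> = 2 * (sin (\<theta> / 2))\<^sup>2"
    using cos_double_sin[of "\<theta> / 2"] by simp
  also have "\<dots> = 2 * \<bar>sin (\<theta> / 2)\<bar> * \<bar>sin (\<theta> / 2)\<bar>"
    by (simp add: power2_eq_square flip: abs_mult)
  also have "\<dots> \<le> 2 * \<bar>sin (\<theta> / 2)\<bar> * 1"
    by (intro mult_left_mono) auto
  also have "\<dots> \<le> \<bar>\<theta>\<bar>" using abs_sin_x_le_abs_x[of "\<theta> / 2"] by simp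
  finally have 1: "1 - cos \<theta> \<le> \<bar>\<theta>\<bar>" .
  have "exp (- a) * (1 - cos \<theta>) \<le> 1 * (1 - cos \<theta>)"
    using assms by (intro mult_right_mono) auto
  moreover have "1 - a \<le> exp (- a)" using exp_ge_add_one_self[of "- a"] by simp
  ultimately show ?thesis using 1 by (simp add: algebra_simps)
qed

text \<open>The phase consists of the central term and the twist of z against w; the decay involves
  the distance of w from e z. Their mixed terms e |z| |w| are split by the arithmetic-geometric
  inequality, so the total loss is \<open>\<bar>l\<bar> * (e\<^sup>2 + (norm w)\<^sup>2)\<close>
  times a quadratic in \<open>norm y\<close>, integrable against the Gaussian.\<close>

lemma Re_e_lag_0_lower:
  fixes y :: "'n::finite heis"
  assumes "e > 0"
  shows "1 - \<bar>l\<bar> * (e\<^sup>2 + (norm w)\<^sup>2) * (1 + norm y)\<^sup>2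
    \<le> Re (e_lag 0 l (heis_mult (heis_inv (dil e y)) (w, 0)))"
proof -
  define z t where "z = fst y" and "t = snd y"
  define \<theta> where "\<theta> = l * (- (e\<^sup>2 * t) - Im (\<Sum>j\<in>UNIV. (e *\<^sub>R z) $ j * cnj (w $ j)) / 2)"
  define a where "a = \<bar>l\<bar> * (norm (w - e *\<^sub>R z))\<^sup>2 / 4"
  have Re: "Re (e_lag 0 l (heis_mult (heis_inv (dil e y)) (w, 0))) = exp (- a) * cos \<theta>"
    by (simp add: e_lag_0 heis_mult_inv a_def \<theta>_def z_def t_def Re_exp)
  have z: "norm z \<le> norm y" and t: "\<bar>t\<bar> \<le> norm y"
    using norm_fst_le[of z t] norm_snd_le[of t z] by (auto simp: z_def t_def)
  have am: "e * norm z * norm w \<le> (e\<^sup>2 * (norm z)\<^sup>2 + (norm w)\<^sup>2) / 2"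
    using sum_squares_ge_zero[of "e * norm z - norm w" 0] by (simp add: power2_eq_square algebra_simps)
  have "\<bar>\<theta>\<bar> \<le> \<bar>l\<bar> * (e\<^sup>2 * \<bar>t\<bar> + (e\<^sup>2 * (norm z)\<^sup>2 + (norm w)\<^sup>2) / 4)"
  proof -
    have "\<bar>Im (\<Sum>j\<in>UNIV. (e *\<^sub>R z) $ j * cnj (w $ j))\<bar> \<le> e * norm z * norm w"
      using Im_hermitian_le[of "e *\<^sub>R z" w] assms by simp
    moreover have "\<bar>e\<^sup>2 * t\<bar> = e\<^sup>2 * \<bar>t\<bar>" by (simp add: abs_mult)
    ultimately have "\<bar>- (e\<^sup>2 * t) - Im (\<Sum>j\<in>UNIV. (e *\<^sub>R z) $ j * cnj (w $ j)) / 2\<bar>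
        \<le> e\<^sup>2 * \<bar>t\<bar> + (e\<^sup>2 * (norm z)\<^sup>2 + (norm w)\<^sup>2) / 4"
      using am by linarith
    then show ?thesis unfolding \<theta>_def abs_mult by (intro mult_left_mono) auto
  qed
  moreover have "a \<le> \<bar>l\<bar> * ((e\<^sup>2 * (norm z)\<^sup>2 + (norm w)\<^sup>2) / 2)"
  proof -
    have "(norm (w - e *\<^sub>R z))\<^sup>2 \<le> (norm w + e * norm z)\<^sup>2"
      using norm_triangle_ineq4[of w "e *\<^sub>R z"] assms by (intro power_mono) auto
    also have "\<dots> \<le> 2 * (e\<^sup>2 * (norm z)\<^sup>2 + (norm w)\<^sup>2)"
      using am by (simp add: power2_eq_square algebra_simps)
    finally have "(norm (w - e *\<^sub>R z))\<^sup>2 / 4 \<le> (e\<^sup>2 * (norm z)\<^sup>2 + (norm w)\<^sup>2) / 2" by simp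
    then show ?thesis unfolding a_def times_divide_eq_right[symmetric] by (intro mult_left_mono) auto
  qed
  \<comment> \<open>The factor 3/4 used next is 1/4 from the phase plus 1/2 from the decay.\<close>
  moreover have "\<bar>l\<bar> * (A + S / 4) + \<bar>l\<bar> * (S / 2) = \<bar>l\<bar> * (A + S * (3 / 4))" for A S :: real
    by (simp add: algebra_simps)
  ultimately have "a + \<bar>\<theta>\<bar> \<le> \<bar>l\<bar> * (e\<^sup>2 * \<bar>t\<bar> + (e\<^sup>2 * (norm z)\<^sup>2 + (norm w)\<^sup>2) * (3 / 4))"
    by (metis add.commute add_mono)
  also have "\<dots> \<le> \<bar>l\<bar> * ((e\<^sup>2 + (norm w)\<^sup>2) * (1 + norm y)\<^sup>2)"
  proof (rule mult_left_mono)
    have "\<bar>t\<bar> + (norm z)\<^sup>2 * (3 / 4) \<le> norm y + (norm y)\<^sup>2"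
      using t power_mono[OF z norm_ge_zero, of 2] zero_le_power2[of "norm z"] by linarith
    also have "\<dots> \<le> (1 + norm y)\<^sup>2" by (simp add: power2_eq_square algebra_simps)
    finally have "e\<^sup>2 * (\<bar>t\<bar> + (norm z)\<^sup>2 * (3 / 4)) \<le> e\<^sup>2 * (1 + norm y)\<^sup>2"
      by (intro mult_left_mono) auto
    moreover have "(norm w)\<^sup>2 * (3 / 4) \<le> (norm w)\<^sup>2 * (1 + norm y)\<^sup>2"
      by (intro mult_left_mono) (auto simp: power2_eq_square algebra_simps)
    ultimately show "e\<^sup>2 * \<bar>t\<bar> + (e\<^sup>2 * (norm z)\<^sup>2 + (norm w)\<^sup>2) * (3 / 4)
        \<le> (e\<^sup>2 + (norm w)\<^sup>2) * (1 + norm y)\<^sup>2"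
      by (simp add: algebra_simps)
  qed simp
  finally show ?thesis
    using exp_times_cos_lower[of a \<theta>] unfolding Re by (simp add: a_def mult.assoc)
qed

lemma measurable_e_lag_0 [measurable]:
  "(\<lambda>x. e_lag 0 l (heis_mult (heis_inv x) (w, 0))) \<in> borel_measurable borel"
  unfolding e_lag_0 heis_mult_inv fst_conv snd_conv
  by (intro borel_measurable_continuous_onI continuous_intros) auto

lemma norm_e_lag_0_le: "norm (e_lag 0 l x) \<le> 1"
  by (simp add: e_lag_0 norm_mult)

section \<open>Lower bounds for transforms of Gaussians\<close>

definition gauss_mass :: "'n::finite itself \<Rightarrow> real" where
  "gauss_mass _ = (LINT x :: 'n heis|lborel. exp (- (norm x)\<^sup>2))"

text \<open>The weight is the quadratic error factor of \<open>Re_e_lag_0_lower\<close>.\<close>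

definition gauss_moment :: "'n::finite itself \<Rightarrow> real" where
  "gauss_moment _ = (LINT x :: 'n heis|lborel. exp (- (norm x)\<^sup>2) * (1 + norm x)\<^sup>2)"

lemma integrable_gauss_mass: "integrable lborel (\<lambda>x :: 'n::finite heis. exp (- (norm x)\<^sup>2))"
  by (rule integrable_poly_gaussian[where C = 1 and k = 0]) auto

lemma integrable_gauss_moment:
  "integrable lborel (\<lambda>x :: 'n::finite heis. exp (- (norm x)\<^sup>2) * (1 + norm x)\<^sup>2)"
  by (rule integrable_poly_gaussian[where C = 1 and k = 2]) auto

lemma gauss_mass_pos: "gauss_mass TYPE('n::finite) > 0"
proof -
  have "(\<integral>\<^sup>+ (x :: 'n heis). ennreal (exp (- (norm x)\<^sup>2)) \<partial>lborel) \<noteq> 0"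
    by (subst nn_integral_0_iff_AE) (auto simp: eventually_False ae_filter_eq_bot_iff)
  then have "gauss_mass TYPE('n) \<noteq> 0"
    unfolding gauss_mass_def
    using nn_integral_eq_integral[OF integrable_gauss_mass[where 'n='n]] by auto
  moreover have "gauss_mass TYPE('n) \<ge> 0" unfolding gauss_mass_def by simp
  ultimately show ?thesis by simp
qed

lemma gauss_moment_pos: "gauss_moment TYPE('n::finite) > 0"
proof -
  have "gauss_mass TYPE('n) \<le> gauss_moment TYPE('n)"
    unfolding gauss_mass_def gauss_moment_def
    by (intro integral_mono integrable_gauss_mass integrable_gauss_moment)
       (auto simp: power2_eq_square algebra_simps)
  then show ?thesis using gauss_mass_pos[where 'n='n] by simp
qed

lemma integrable_hgauss:
  assumes "e > 0"
  shows "integrable lborel (hgauss e :: 'n::finite heis \<Rightarrow> real)"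
proof -
  have "hgauss e (dil e x) = exp (- (norm x)\<^sup>2) / e ^ hdim TYPE('n)" for x :: "'n heis"
    using hgauss_dil[OF assms, of x] assms by (simp add: field_simps)
  then show ?thesis
    using integrable_divide[OF integrable_gauss_mass] by (subst integrable_dil_iff[OF assms]) auto
qed

lemma integral_hgauss:
  assumes "e > 0"
  shows "(LINT x|lborel. hgauss e (x :: 'n::finite heis)) = gauss_mass TYPE('n)"
  unfolding gauss_mass_def
  by (subst integral_dil[OF assms])
     (auto simp: hgauss_dil[OF assms, symmetric] simp flip: integral_mult_right_zero)

lemma integrable_hgauss_e_lag:
  assumes "e > 0"
  shows "integrable lborel (\<lambda>x :: 'n::finite heis. complex_of_real (hgauss e x) *
    e_lag 0 l (heis_mult (heis_inv x) (w, 0)))"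
  by (rule Bochner_Integration.integrable_bound[OF integrable_hgauss[OF assms]])
     (auto simp: norm_mult norm_e_lag_0_le hgauss_nonneg[OF assms] intro!: mult_left_le)

text \<open>After the substitution x = dil e y the Gaussian no longer depends on \<open>e\<close>,
  which survives only in the kernel. The pointwise bound then integrates to two constants
  independent of \<open>e\<close>, \<open>l\<close> and \<open>w\<close>.\<close>

lemma Re_integral_hgauss_e_lag:
  assumes "e > 0"
  shows "gauss_mass TYPE('n) - \<bar>l\<bar> * (e\<^sup>2 + (norm w)\<^sup>2) * gauss_moment TYPE('n)
    \<le> Re (LINT x :: 'n::finite heis|lborel. complex_of_real (hgauss e x) *
            e_lag 0 l (heis_mult (heis_inv x) (w, 0)))"
proof -
  let ?E = "\<lambda>x :: 'n heis. e_lag 0 l (heis_mult (heis_inv x) (w, 0))"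
  let ?f = "\<lambda>x :: 'n heis. complex_of_real (hgauss e x) * ?E x"
  let ?K = "\<bar>l\<bar> * (e\<^sup>2 + (norm w)\<^sup>2)"
  have int: "integrable lborel (\<lambda>x. ?f (dil e x))"
    using integrable_hgauss_e_lag[OF assms] by (subst integrable_dil_iff[OF assms, symmetric]) auto
  have "gauss_mass TYPE('n) - ?K * gauss_moment TYPE('n) =
    (LINT x :: 'n heis|lborel. exp (- (norm x)\<^sup>2) - ?K * (exp (- (norm x)\<^sup>2) * (1 + norm x)\<^sup>2))"
    unfolding gauss_mass_def gauss_moment_def
    by (simp add: integrable_gauss_mass integrable_gauss_moment)
  also have "\<dots> \<le> (LINT x|lborel. e ^ hdim TYPE('n) * Re (?f (dil e x)))"
  proof (rule integral_mono)
    show "integrable lborel (\<lambda>x. e ^ hdim TYPE('n) * Re (?f (dil e x)))"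
      by (intro integrable_mult_right integrable_Re int)
    show "integrable lborel (\<lambda>x :: 'n heis. exp (- (norm x)\<^sup>2) - ?K * (exp (- (norm x)\<^sup>2) * (1 + norm x)\<^sup>2))"
      by (intro Bochner_Integration.integrable_diff integrable_mult_right integrable_gauss_mass integrable_gauss_moment)
    fix x :: "'n heis"
    have "exp (- (norm x)\<^sup>2) - ?K * (exp (- (norm x)\<^sup>2) * (1 + norm x)\<^sup>2) =
      exp (- (norm x)\<^sup>2) * (1 - ?K * (1 + norm x)\<^sup>2)" by (simp add: algebra_simps)
    also have "\<dots> \<le> exp (- (norm x)\<^sup>2) * Re (?E (dil e x))"
      by (intro mult_left_mono Re_e_lag_0_lower assms) auto
    also have "\<dots> = e ^ hdim TYPE('n) * Re (?f (dil e x))"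
      unfolding hgauss_dil[OF assms, symmetric] by (simp add: mult.assoc)
    finally show "exp (- (norm x)\<^sup>2) - ?K * (exp (- (norm x)\<^sup>2) * (1 + norm x)\<^sup>2)
      \<le> e ^ hdim TYPE('n) * Re (?f (dil e x))" .
  qed
  also have "\<dots> = e ^ hdim TYPE('n) * Re (LINT x|lborel. ?f (dil e x))"
    by (simp only: integral_mult_right_zero integral_Re[OF int])
  also have "\<dots> = Re (LINT x|lborel. ?f x)"
    by (subst (2) integral_dil[OF assms]) auto
  finally show ?thesis .
qed

text \<open>For k = 0 the normalising quotient of factorials equals 1.\<close>

lemma strichartz_ft_normalized_first_ray:
  fixes f :: "'n::finite heis \<Rightarrow> complex"
  assumes "l \<noteq> 0"
  shows "strichartz_ft_normalized f (l, real CARD('n) * \<bar>l\<bar>) w =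
    (LINT x|lborel. f x * e_lag 0 l (heis_mult (heis_inv x) (w, 0)))"
  using assms ray_index_eq[of l "CARD('n)" 0]
  by (simp add: strichartz_ft_normalized_def strichartz_ft_def Let_def)

text \<open>Real parts, unlike moduli, add up without cancellation. The smallness condition lets the
  error consume at most half of the mass of each summand.\<close>

lemma strichartz_ft_sum_hgauss_lower:
  assumes J: "finite J" and e: "\<And>j. j \<in> J \<Longrightarrow> e j > 0" and l: "l \<noteq> 0"
    and small: "\<And>j. j \<in> J \<Longrightarrow> \<bar>l\<bar> * ((e j)\<^sup>2 + (norm w)\<^sup>2) \<le> gauss_mass TYPE('n) / (2 * gauss_moment TYPE('n))"
  shows "real (card J) * (gauss_mass TYPE('n) / 2) \<le> norm (strichartz_ft_normalized
    (\<lambda>x :: 'n::finite heis. complex_of_real (\<Sum>j\<in>J. hgauss (e j) x)) (l, real CARD('n) * \<bar>l\<bar>) w)"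
proof -
  let ?E = "\<lambda>x :: 'n heis. e_lag 0 l (heis_mult (heis_inv x) (w, 0))"
  have "real (card J) * (gauss_mass TYPE('n) / 2) = (\<Sum>j\<in>J. gauss_mass TYPE('n) / 2)" by simp
  also have "\<dots> \<le> (\<Sum>j\<in>J. Re (LINT x|lborel. complex_of_real (hgauss (e j) x) * ?E x))"
  proof (rule sum_mono)
    fix j assume j: "j \<in> J"
    have "\<bar>l\<bar> * ((e j)\<^sup>2 + (norm w)\<^sup>2) * gauss_moment TYPE('n) \<le> gauss_mass TYPE('n) / 2"
      using mult_right_mono[OF small[OF j], of "gauss_moment TYPE('n)"] gauss_moment_pos[where 'n='n] by simp
    then show "gauss_mass TYPE('n) / 2 \<le> Re (LINT x|lborel. complex_of_real (hgauss (e j) x) * ?E x)"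
      using Re_integral_hgauss_e_lag[OF e[OF j], of l w] by linarith
  qed
  also have "\<dots> = Re (LINT x|lborel. (\<Sum>j\<in>J. complex_of_real (hgauss (e j) x) * ?E x))"
    using e by (subst Bochner_Integration.integral_sum) (auto intro!: integrable_hgauss_e_lag)
  also have "\<dots> = Re (strichartz_ft_normalized
    (\<lambda>x :: 'n::finite heis. complex_of_real (\<Sum>j\<in>J. hgauss (e j) x)) (l, real CARD('n) * \<bar>l\<bar>) w)"
    by (simp add: strichartz_ft_normalized_first_ray[OF l] sum_distrib_right)
  also have "\<dots> \<le> norm (strichartz_ft_normalized
    (\<lambda>x :: 'n::finite heis. complex_of_real (\<Sum>j\<in>J. hgauss (e j) x)) (l, real CARD('n) * \<bar>l\<bar>) w)"
    by (rule complex_Re_le_cmod)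
  finally show ?thesis .
qed

section \<open>The two sides of Pitt's inequality\<close>

definition pitt_lhs :: "real \<Rightarrow> real \<Rightarrow> real \<Rightarrow> ('n::finite heis \<Rightarrow> complex) \<Rightarrow> ennreal" where
  "pitt_lhs q \<sigma> \<rho> f = (\<integral>\<^sup>+ (a, w). ennreal (norm (strichartz_ft_normalized f a w) powr q
      * u_weight \<sigma> \<rho> a w powr q) \<partial>(nu2 CARD('n) \<Otimes>\<^sub>M lborel))"

definition pitt_rhs :: "real \<Rightarrow> real \<Rightarrow> ('n::finite heis \<Rightarrow> complex) \<Rightarrow> ennreal" where
  "pitt_rhs p \<alpha> f = (\<integral>\<^sup>+ x. ennreal (norm (f x) powr p * v_weight \<alpha> x powr p) \<partial>lborel)"

text \<open>Serves the half l > 0 of the first ray. The exponent will be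
  \<open>2 * real CARD('n) - \<sigma> * q\<close>, combining the density of \<open>nu2\<close> with
  the weight.\<close>

definition ray_mass :: "real \<Rightarrow> real \<Rightarrow> ennreal" where
  "ray_mass s B = (\<integral>\<^sup>+ l. indicator {1<..<B} l * ennreal (l powr s) \<partial>lborel)"

text \<open>The origin is removed to match \<open>u_weight\<close>, which vanishes at w = 0.\<close>

definition ball_mass :: "'n::finite itself \<Rightarrow> real \<Rightarrow> real \<Rightarrow> ennreal" where
  "ball_mass _ s r = (\<integral>\<^sup>+ (w :: complex ^ 'n). indicator (cball 0 r - {0}) w * ennreal (norm w powr (- s)) \<partial>lborel)"

lemma measurable_punctured_power [measurable]:
  "(\<lambda>w :: complex ^ 'n::finite. indicator (cball 0 r - {0}) w * ennreal (norm w powr s)) \<in> borel_measurable borel"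
proof (rule borel_measurable_times_ennreal)
  have "(\<lambda>w :: complex ^ 'n. norm w) \<in> borel_measurable borel"
    by (intro borel_measurable_continuous_onI continuous_intros)
  moreover have "(\<lambda>x :: real. ennreal (x powr s)) \<in> borel_measurable borel" by measurable
  ultimately show "(\<lambda>w :: complex ^ 'n. ennreal (norm w powr s)) \<in> borel_measurable borel"
    by (rule measurable_compose)
  show "indicator (cball 0 r - {0 :: complex ^ 'n}) \<in> borel_measurable borel"
    by (intro borel_measurable_indicator sets.Diff borel_closed) auto
qed

lemma nn_integral_nu2_ge_first_ray:
  assumes "\<phi> \<in> borel_measurable (restrict_space borel (heis_fan n))"
  shows "ennreal (1 / (2 * pi) ^ (2 * n + 1)) *
      (\<integral>\<^sup>+ l. \<phi> (l, real n * \<bar>l\<bar>) * ennreal (\<bar>l\<bar> ^ (2 * n)) \<partial>lborel) \<le> (\<integral>\<^sup>+ a. \<phi> a \<partial>nu2 n)"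
proof -
  let ?t = "\<lambda>l k. ennreal ((fact (k + n - 1) / (fact k * fact (n - 1)))\<^sup>2) * \<phi> (l, real (2 * k + n) * \<bar>l\<bar>)"
  have "\<phi> (l, real n * \<bar>l\<bar>) \<le> (\<Sum>k. ?t l k)" for l
    using sum_le_suminf[of "?t l" "{0}"] by simp
  then show ?thesis
    unfolding nn_integral_nu2[OF assms]
    by (intro mult_left_mono nn_integral_mono mult_right_mono) auto
qed

lemma pitt_lhs_lower:
  fixes f :: "'n::finite heis \<Rightarrow> complex"
  assumes "m \<ge> 0" "q > 0"
    and low: "\<And>l w. 1 < l \<Longrightarrow> l < B \<Longrightarrow> norm w \<le> r \<Longrightarrow>
      m \<le> norm (strichartz_ft_normalized f (l, real CARD('n) * \<bar>l\<bar>) w)"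
  shows "ennreal (m powr q * (real CARD('n) powr (- (\<sigma> * q)) / (2 * pi) ^ (2 * CARD('n) + 1)))
      * (ray_mass (2 * real CARD('n) - \<sigma> * q) B * ball_mass TYPE('n) (\<rho> * q) r) \<le> pitt_lhs q \<sigma> \<rho> f"
proof -
  let ?n = "CARD('n)"
  \<comment> \<open>The portion 1 < l < B of the first ray, written as a Borel subset of the
    plane.\<close>
  define A where "A = {a :: real \<times> real. 1 < fst a \<and> fst a < B \<and> snd a = real ?n * fst a}"
  define \<Phi> where "\<Phi> = (\<lambda>a. indicator A a * ennreal (snd a powr (- (\<sigma> * q))))"
  define \<Psi> where "\<Psi> = (\<lambda>w :: complex ^ 'n. indicator (cball 0 r - {0}) w * ennreal (norm w powr (- (\<rho> * q))))"
  have "A \<in> sets borel"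
  proof -
    have "A = {a. 1 < fst a} \<inter> {a. fst a < B} \<inter> {a. snd a = real ?n * fst a}" by (auto simp: A_def)
    moreover have "open {a :: real \<times> real. 1 < fst a}" "open {a :: real \<times> real. fst a < B}"
      "closed {a :: real \<times> real. snd a = real ?n * fst a}"
      by (intro open_Collect_less closed_Collect_eq continuous_intros)+
    ultimately show ?thesis by (simp add: borel_open borel_closed sets.Int)
  qed
  have "\<Phi> \<in> borel_measurable borel"
  proof -
    have "(\<lambda>a :: real \<times> real. snd a) \<in> borel_measurable borel"
      by (intro borel_measurable_continuous_onI continuous_intros)
    moreover have "(\<lambda>x :: real. ennreal (x powr (- (\<sigma> * q)))) \<in> borel_measurable borel" by measurable
    ultimately have "(\<lambda>a :: real \<times> real. ennreal (snd a powr (- (\<sigma> * q)))) \<in> borel_measurable borel"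
      by (rule measurable_compose)
    with \<open>A \<in> sets borel\<close> show ?thesis
      unfolding \<Phi>_def by (intro borel_measurable_times_ennreal borel_measurable_indicator)
  qed
  then have \<Phi>: "\<Phi> \<in> borel_measurable (restrict_space borel (heis_fan ?n))"
    by (rule measurable_restrict_space1)
  have sets: "sets (nu2 ?n) = sets (restrict_space borel (heis_fan ?n))"
    by (simp add: nu2_def)
  have \<Phi>': "\<Phi> \<in> borel_measurable (nu2 ?n)"
    using \<Phi> unfolding measurable_cong_sets[OF sets refl] .
  have \<Psi>: "\<Psi> \<in> borel_measurable lborel"
    unfolding \<Psi>_def measurable_lborel1 measurable_lborel2 by (rule measurable_punctured_power)
  have "ennreal (m powr q) * (\<Phi> a * \<Psi> w) \<le> ennreal (norm (strichartz_ft_normalized f a w) powr q * u_weight \<sigma> \<rho> a w powr q)"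
    for a w
  proof (cases "a \<in> A \<and> w \<in> cball 0 r - {0}")
    case True
    then obtain l where a: "a = (l, real ?n * \<bar>l\<bar>)" and l: "1 < l" "l < B"
      by (cases a) (auto simp: A_def)
    have "m powr q * (snd a powr (- (\<sigma> * q)) * norm w powr (- (\<rho> * q)))
        \<le> norm (strichartz_ft_normalized f a w) powr q * u_weight \<sigma> \<rho> a w powr q"
    proof (rule mult_mono)
      show "m powr q \<le> norm (strichartz_ft_normalized f a w) powr q"
        using True assms l unfolding a by (intro powr_mono2 low) auto
      show "snd a powr (- (\<sigma> * q)) * norm w powr (- (\<rho> * q)) \<le> u_weight \<sigma> \<rho> a w powr q"
        using True l by (simp add: a u_weight_def powr_mult powr_powr)
    qed auto
    then show ?thesis using True
      by (simp add: \<Phi>_def \<Psi>_def ennreal_leI flip: ennreal_mult)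
  qed (auto simp: \<Phi>_def \<Psi>_def)
  \<comment> \<open>Monotonicity of the upper integral requires no measurability of the integrand,
    so only the product minorant has to be measurable.\<close>
  then have 1: "(\<integral>\<^sup>+ x. ennreal (m powr q) * (\<Phi> (fst x) * \<Psi> (snd x)) \<partial>(nu2 ?n \<Otimes>\<^sub>M lborel)) \<le> pitt_lhs q \<sigma> \<rho> f"
    unfolding pitt_lhs_def by (intro nn_integral_mono) (auto simp: split_beta')
  have 2: "(\<integral>\<^sup>+ x. ennreal (m powr q) * (\<Phi> (fst x) * \<Psi> (snd x)) \<partial>(nu2 ?n \<Otimes>\<^sub>M lborel))
      = ennreal (m powr q) * ((\<integral>\<^sup>+ a. \<Phi> a \<partial>nu2 ?n) * ball_mass TYPE('n) (\<rho> * q) r)"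
  proof -
    have meas: "(\<lambda>x. \<Phi> (fst x) * \<Psi> (snd x)) \<in> borel_measurable (nu2 ?n \<Otimes>\<^sub>M lborel)"
      by (intro borel_measurable_times_ennreal measurable_compose[OF measurable_fst \<Phi>']
          measurable_compose[OF measurable_snd \<Psi>])
    have "(\<integral>\<^sup>+ x. \<Phi> (fst x) * \<Psi> (snd x) \<partial>(nu2 ?n \<Otimes>\<^sub>M lborel))
        = (\<integral>\<^sup>+ a. \<integral>\<^sup>+ w. \<Phi> a * \<Psi> w \<partial>lborel \<partial>nu2 ?n)"
      using lborel.nn_integral_fst[OF meas] by simp
    also have "\<dots> = (\<integral>\<^sup>+ a. \<Phi> a * ball_mass TYPE('n) (\<rho> * q) r \<partial>nu2 ?n)"
      by (simp only: nn_integral_cmult[OF \<Psi>] ball_mass_def flip: \<Psi>_def)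
    also have "\<dots> = (\<integral>\<^sup>+ a. \<Phi> a \<partial>nu2 ?n) * ball_mass TYPE('n) (\<rho> * q) r"
      by (rule nn_integral_multc[OF \<Phi>'])
    finally show ?thesis by (simp add: nn_integral_cmult[OF meas])
  qed
  have 3: "ennreal (real ?n powr (- (\<sigma> * q)) / (2 * pi) ^ (2 * ?n + 1)) * ray_mass (2 * real ?n - \<sigma> * q) B
      \<le> (\<integral>\<^sup>+ a. \<Phi> a \<partial>nu2 ?n)"
  proof -
    have "\<Phi> (l, real ?n * \<bar>l\<bar>) * ennreal (\<bar>l\<bar> ^ (2 * ?n)) =
        ennreal (real ?n powr (- (\<sigma> * q))) * (indicator {1<..<B} l * ennreal (l powr (2 * real ?n - \<sigma> * q)))" for l
    proof (cases "1 < l \<and> l < B")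
      case True
      have l: "l powr real (2 * ?n) = l ^ (2 * ?n)"
        using True by (intro powr_realpow) auto
      have "(real ?n * l) powr (- (\<sigma> * q)) * l ^ (2 * ?n) =
          real ?n powr (- (\<sigma> * q)) * (l powr (- (\<sigma> * q)) * l powr real (2 * ?n))"
        by (simp only: l powr_mult mult.assoc)
      also have "l powr (- (\<sigma> * q)) * l powr real (2 * ?n) = l powr (2 * real ?n - \<sigma> * q)"
        by (simp flip: powr_add)
      finally show ?thesis
        using True by (simp add: \<Phi>_def A_def flip: ennreal_mult)
    qed (auto simp: \<Phi>_def A_def indicator_def)
    then have "ennreal (1 / (2 * pi) ^ (2 * ?n + 1)) * (\<integral>\<^sup>+ l. ennreal (real ?n powr (- (\<sigma> * q))) *
        (indicator {1<..<B} l * ennreal (l powr (2 * real ?n - \<sigma> * q))) \<partial>lborel) \<le> (\<integral>\<^sup>+ a. \<Phi> a \<partial>nu2 ?n)"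
      using nn_integral_nu2_ge_first_ray[OF \<Phi>] by simp
    also have "(\<integral>\<^sup>+ l. ennreal (real ?n powr (- (\<sigma> * q))) *
        (indicator {1<..<B} l * ennreal (l powr (2 * real ?n - \<sigma> * q))) \<partial>lborel)
        = ennreal (real ?n powr (- (\<sigma> * q))) * ray_mass (2 * real ?n - \<sigma> * q) B"
      unfolding ray_mass_def by (rule nn_integral_cmult) measurable
    finally show ?thesis by (simp add: mult.assoc[symmetric] flip: ennreal_mult)
  qed
  have "ennreal (m powr q) * ((ennreal (real ?n powr (- (\<sigma> * q)) / (2 * pi) ^ (2 * ?n + 1)) *
      ray_mass (2 * real ?n - \<sigma> * q) B) * ball_mass TYPE('n) (\<rho> * q) r) \<le> pitt_lhs q \<sigma> \<rho> f"
    using order_trans[OF mult_left_mono[OF mult_right_mono[OF 3]] 1[unfolded 2]] by simp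
  moreover have "ennreal (a * b) * (X * Y) = ennreal a * ((ennreal b * X) * Y)" if "a \<ge> 0" for a b X Y
    using that by (simp only: ennreal_mult' mult.assoc)
  ultimately show ?thesis by (simp only: powr_ge_zero)
qed

section \<open>Growth of the ray and ball integrals\<close>

lemma nn_integral_ge_const_on:
  assumes "S \<in> sets M" "\<And>x. x \<in> S \<Longrightarrow> ennreal c \<le> f x"
  shows "ennreal c * emeasure M S \<le> (\<integral>\<^sup>+ x. f x \<partial>M)"
proof -
  have "ennreal c * emeasure M S = (\<integral>\<^sup>+ x. ennreal c * indicator S x \<partial>M)"
    using assms by (simp add: nn_integral_cmult_indicator)
  also have "\<dots> \<le> (\<integral>\<^sup>+ x. f x \<partial>M)"
    using assms by (intro nn_integral_mono) (auto simp: indicator_def)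
  finally show ?thesis .
qed

text \<open>Treats both signs of the exponent at once, as \<open>2 n - \<sigma> q\<close> may have
  either.\<close>

lemma powr_ge_min_endpoints:
  fixes x :: real
  assumes "0 < a" "a \<le> x" "x \<le> b"
  shows "min (a powr s) (b powr s) \<le> x powr s"
proof (cases "s \<ge> 0")
  case True
  then show ?thesis using assms by (auto intro!: min.coboundedI1 powr_mono2)
next
  case False
  then show ?thesis using assms by (auto intro!: min.coboundedI2 powr_mono2')
qed

text \<open>Keeps only the top dyadic block, on which \<open>l powr s\<close> is comparable to
  \<open>B powr s\<close>. This is the true order of growth for s > -1; the factor 1/2 is the
  relative length of the block.\<close>

lemma ray_mass_ge_dyadic:
  assumes "B \<ge> 2"
  shows "ennreal (min ((1 / 2) powr s) 1 / 2 * B powr (s + 1)) \<le> ray_mass s B"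
proof -
  let ?c = "min ((B / 2) powr s) (B powr s)"
  have "ennreal ?c * emeasure lborel {B/2<..<B} \<le> ray_mass s B"
    unfolding ray_mass_def
  proof (rule nn_integral_ge_const_on)
    fix x assume x: "x \<in> {B/2<..<B}"
    then have "ennreal ?c \<le> ennreal (x powr s)"
      using assms by (intro ennreal_leI powr_ge_min_endpoints) auto
    then show "ennreal ?c \<le> indicator {1<..<B} x * ennreal (x powr s)"
      using x assms by simp
  qed simp
  moreover have "?c = min ((1 / 2) powr s) 1 * B powr s"
    using assms powr_mult[of "1/2" B s] by (auto simp: min_mult_distrib_right)
  moreover have "B powr s * B = B powr (s + 1)"
    using assms by (simp add: powr_add)
  ultimately show ?thesis
    using assms by (simp add: mult.assoc flip: ennreal_mult)
qed

text \<open>Keeps only the bottom block (1, 2). This is the true order for s < -1, where the whole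
  integral stays bounded in \<open>B\<close>.\<close>

lemma ray_mass_ge_const:
  assumes "B \<ge> 2"
  shows "ennreal (min 1 (2 powr s)) \<le> ray_mass s B"
proof -
  have "ennreal (min 1 (2 powr s)) * emeasure lborel {1<..<2::real} \<le> ray_mass s B"
    unfolding ray_mass_def
  proof (rule nn_integral_ge_const_on)
    fix x :: real assume x: "x \<in> {1<..<2}"
    then have "ennreal (min 1 (2 powr s)) \<le> ennreal (x powr s)"
      using powr_ge_min_endpoints[of 1 x 2 s] by (intro ennreal_leI) auto
    then show "ennreal (min 1 (2 powr s)) \<le> indicator {1<..<B} x * ennreal (x powr s)"
      using x assms by simp
  qed simp
  then show ?thesis by simp
qed

text \<open>In the critical case every dyadic block carries the same mass, and a single block would
  lose the logarithm that forces strict inequality.\<close>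

lemma ray_mass_minus_one:
  assumes "B \<ge> 1"
  shows "ray_mass (- 1) B = ennreal (ln B)"
proof -
  have "ray_mass (- 1) B = (\<integral>\<^sup>+ l. ennreal (1 / l) * indicator {1..B} l \<partial>lborel)"
    unfolding ray_mass_def
  proof (rule nn_integral_cong_AE)
    have "AE l in lborel. l \<noteq> 1 \<and> l \<noteq> B"
      by (intro AE_conjI AE_lborel_singleton)
    then show "AE l in lborel. indicator {1<..<B} l * ennreal (l powr - 1) = ennreal (1 / l) * indicator {1..B} l"
      by eventually_elim (auto simp: indicator_def powr_minus_divide)
  qed
  also have "\<dots> = ennreal (ln B - ln 1)"
    using assms by (intro nn_integral_FTC_Icc) (auto intro!: derivative_eq_intros)
  finally show ?thesis by simp
qed

lemma emeasure_cball_minus_0: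
  "r \<ge> 0 \<Longrightarrow> emeasure lborel (cball 0 r - {0 :: complex ^ 'n::finite}) =
    ennreal (unit_ball_vol (real (2 * CARD('n))) * r ^ (2 * CARD('n)))"
  using emeasure_cball[of r "0 :: complex ^ 'n"]
  by (subst emeasure_Diff_null_set) (auto simp: mult.commute)

lemma ball_mass_ge:
  assumes "r > 0" "s \<ge> 0"
  shows "ennreal (unit_ball_vol (real (2 * CARD('n))) * r powr (2 * real CARD('n) - s)) \<le> ball_mass TYPE('n::finite) s r"
proof -
  have "ennreal (r powr (- s)) * emeasure lborel (cball 0 r - {0 :: complex ^ 'n}) \<le> ball_mass TYPE('n) s r"
    unfolding ball_mass_def using assms
    by (intro nn_integral_ge_const_on) (auto intro!: ennreal_leI powr_mono2')
  moreover have "r powr (- s) * r ^ (2 * CARD('n)) = r powr (2 * real CARD('n) - s)"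
    using assms by (simp flip: powr_realpow powr_add)
  ultimately show ?thesis
    using assms by (simp add: emeasure_cball_minus_0 mult.left_commute[of "r powr _"] flip: ennreal_mult)
qed

lemma nn_integral_scaleR:
  fixes f :: "'a::euclidean_space \<Rightarrow> ennreal"
  assumes "c > 0" and [measurable]: "f \<in> borel_measurable borel"
  shows "(\<integral>\<^sup>+ x. f x \<partial>lborel) = ennreal (c ^ DIM('a)) * (\<integral>\<^sup>+ x. f (c *\<^sub>R x) \<partial>lborel)"
  using assms(1)
  by (subst lborel_affine[of c 0])
     (simp_all add: nn_integral_density nn_integral_distr nn_integral_cmult)

lemma ball_mass_half:
  assumes "r > 0"
  shows "ball_mass TYPE('n::finite) s (r / 2) = ennreal (2 powr (s - 2 * real CARD('n))) * ball_mass TYPE('n) s r"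
proof -
  let ?f = "\<lambda>r (w :: complex ^ 'n). indicator (cball 0 r - {0}) w * ennreal (norm w powr (- s))"
  have "ball_mass TYPE('n) s (r / 2) = ennreal ((1 / 2) ^ (2 * CARD('n))) * (\<integral>\<^sup>+ w. ?f (r / 2) ((1 / 2) *\<^sub>R w) \<partial>lborel)"
  proof -
    have half: "0 < (1 / 2 :: real)" and dim: "DIM(complex ^ 'n) = 2 * CARD('n)" by simp_all
    show ?thesis
      using nn_integral_scaleR[OF half measurable_punctured_power[of "r / 2" "- s", where 'n='n]]
      unfolding dim ball_mass_def .
  qed
  also have "\<dots> = (\<integral>\<^sup>+ w. ennreal ((1 / 2) ^ (2 * CARD('n))) * ?f (r / 2) ((1 / 2) *\<^sub>R w) \<partial>lborel)"
    by (rule nn_integral_cmult[symmetric], simp only: measurable_lborel2)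
       (intro measurable_compose[OF _ measurable_punctured_power] borel_measurable_continuous_onI continuous_intros)
  also have "\<dots> = (\<integral>\<^sup>+ w. ennreal (2 powr (s - 2 * real CARD('n))) * ?f r w \<partial>lborel)"
  proof (rule nn_integral_cong)
    fix w :: "complex ^ 'n"
    have "(1 / 2) ^ (2 * CARD('n)) * (norm w / 2) powr (- s) = 2 powr (s - 2 * real CARD('n)) * norm w powr (- s)"
    proof -
      have "(1 / 2 :: real) ^ (2 * CARD('n)) = 2 powr (- real (2 * CARD('n)))"
        by (simp only: powr_minus powr_realpow zero_less_numeral power_one_over power_inverse divide_inverse mult_1)
      moreover have "(norm w / 2) powr (- s) = 2 powr s * norm w powr (- s)"
        by (simp add: powr_divide powr_minus field_simps)
      moreover have "2 powr (- real (2 * CARD('n))) * 2 powr s = 2 powr (s - 2 * real CARD('n))"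
        by (simp flip: powr_add)
      ultimately show ?thesis by (simp only: mult.assoc[symmetric])
    qed
    then show "ennreal ((1 / 2) ^ (2 * CARD('n))) * ?f (r / 2) ((1 / 2) *\<^sub>R w) = ennreal (2 powr (s - 2 * real CARD('n))) * ?f r w"
      by (auto simp: indicator_def simp flip: ennreal_mult)
  qed
  also have "\<dots> = ennreal (2 powr (s - 2 * real CARD('n))) * ball_mass TYPE('n) s r"
    unfolding ball_mass_def by (rule nn_integral_cmult) measurable
  finally show ?thesis .
qed

text \<open>Scaling replaces polar coordinates. For \<open>s\<close> at least the real dimension,
  halving the radius does not decrease the integral, by \<open>ball_mass_half\<close>; yet the
  annulus that is lost carries positive mass. Both cannot hold for a finite value.\<close>

lemma ball_mass_eq_top:
  assumes "r > 0" "s \<ge> 2 * real CARD('n)"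
  shows "ball_mass TYPE('n::finite) s r = \<infinity>"
proof (rule ccontr)
  assume "ball_mass TYPE('n) s r \<noteq> \<infinity>"
  let ?X = "ball_mass TYPE('n) s"
  let ?A = "cball 0 r - cball 0 (r / 2) :: (complex ^ 'n) set"
  let ?v = "unit_ball_vol (real (2 * CARD('n)))"
  let ?d = "2 * CARD('n)"
  have "?X r \<le> ?X (r / 2)"
  proof -
    have "1 * ?X r \<le> ennreal (2 powr (s - 2 * real CARD('n))) * ?X r"
      using assms by (intro mult_right_mono) (auto simp: ge_one_powr_ge_zero simp flip: ennreal_1)
    then show ?thesis using ball_mass_half[OF assms(1), where 'n='n and s=s] by simp
  qed
  have A: "emeasure lborel ?A = ennreal (?v * (r ^ ?d - (r / 2) ^ ?d))"
  proof -
    have "emeasure lborel ?A = emeasure lborel (cball (0 :: complex ^ 'n) r) - emeasure lborel (cball (0 :: complex ^ 'n) (r / 2))"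
      using assms by (intro emeasure_Diff) (auto simp: emeasure_cball intro: order_trans)
    then show ?thesis
      using assms by (simp add: emeasure_cball ennreal_minus right_diff_distrib mult.commute)
  qed
  have pos: "r powr (- s) * (?v * (r ^ ?d - (r / 2) ^ ?d)) > 0"
  proof -
    have "(r / 2) ^ ?d < r ^ ?d" using assms by (intro power_strict_mono) auto
    then show ?thesis using assms by (simp add: zero_less_mult_iff)
  qed
  have "ennreal (r powr (- s)) * emeasure lborel ?A + ?X r
      \<le> ennreal (r powr (- s)) * emeasure lborel ?A + ?X (r / 2)"
    by (intro add_left_mono \<open>?X r \<le> ?X (r / 2)\<close>)
  also have "\<dots> = (\<integral>\<^sup>+ w. ennreal (r powr (- s)) * indicator ?A w \<partial>lborel) + ?X (r / 2)"
    by (subst nn_integral_cmult_indicator) auto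
  also have "\<dots> = (\<integral>\<^sup>+ w. ennreal (r powr (- s)) * indicator ?A w
      + indicator (cball 0 (r / 2) - {0}) w * ennreal (norm w powr (- s)) \<partial>lborel)"
    unfolding ball_mass_def
  proof (rule nn_integral_add[symmetric])
    show "(\<lambda>w. ennreal (r powr (- s)) * indicator ?A w) \<in> borel_measurable lborel"
      by (intro borel_measurable_times_ennreal borel_measurable_indicator borel_measurable_const) auto
    show "(\<lambda>w :: complex ^ 'n. indicator (cball 0 (r / 2) - {0}) w * ennreal (norm w powr (- s))) \<in> borel_measurable lborel"
      unfolding measurable_lborel2 by (rule measurable_punctured_power)
  qed
  also have "\<dots> \<le> ?X r"
    unfolding ball_mass_def
  proof (rule nn_integral_mono)
    fix w :: "complex ^ 'n"
    have "ennreal (r powr (- s)) \<le> ennreal (norm w powr (- s))" if "norm w \<le> r" "w \<noteq> 0"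
      using that assms by (intro ennreal_leI powr_mono2') auto
    then show "ennreal (r powr (- s)) * indicator ?A w + indicator (cball 0 (r / 2) - {0}) w * ennreal (norm w powr (- s))
        \<le> indicator (cball 0 r - {0}) w * ennreal (norm w powr (- s))"
      using assms by (auto simp: indicator_def)
  qed
  finally have "ennreal (r powr (- s) * (?v * (r ^ ?d - (r / 2) ^ ?d))) + ?X r \<le> ?X r"
    unfolding A by (simp only: ennreal_mult'[OF powr_ge_zero])
  moreover obtain x where "x \<ge> 0" "?X r = ennreal x"
    using \<open>?X r \<noteq> \<infinity>\<close> by (cases "?X r") auto
  ultimately have "ennreal (r powr (- s) * (?v * (r ^ ?d - (r / 2) ^ ?d)) + x) \<le> ennreal x"
    using pos by (subst ennreal_plus) auto
  then show False
    using pos \<open>x \<ge> 0\<close> by (subst (asm) ennreal_le_iff) auto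
qed

section \<open>From extended to real inequalities\<close>

lemma ennreal_powr_ennreal: "a \<ge> 0 \<Longrightarrow> ennreal_powr (ennreal a) r = ennreal (a powr r)"
  by (simp add: ennreal_powr_def)

lemma ennreal_powr_mono:
  assumes "x \<le> y" "r \<ge> 0"
  shows "ennreal_powr x r \<le> ennreal_powr y r"
  using assms
  by (cases x; cases y) (auto simp: ennreal_powr_def top_unique intro!: ennreal_leI powr_mono2)

lemma pitt_bound:
  assumes "ennreal_powr L (1 / q) \<le> ennreal C * ennreal_powr R (1 / p)"
    and "p > 0" "q > 0" and R: "R \<le> ennreal b" "b \<ge> 0"
  shows "L \<noteq> \<infinity>" and "a \<ge> 0 \<Longrightarrow> ennreal a \<le> L \<Longrightarrow> a powr (1 / q) \<le> max C 0 * b powr (1 / p)"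
proof -
  \<comment> \<open>\<open>ennreal C\<close> is 0 for negative \<open>C\<close>, so
    \<open>max C 0\<close> is the real number that it represents.\<close>
  have "ennreal C * ennreal_powr R (1 / p) \<le> ennreal (max C 0) * ennreal (b powr (1 / p))"
    using ennreal_powr_mono[OF R(1), of "1 / p"] assms
    by (intro mult_mono) (auto simp: ennreal_powr_ennreal intro: ennreal_leI)
  then have *: "ennreal_powr L (1 / q) \<le> ennreal (max C 0 * b powr (1 / p))"
    using assms(1) by (simp add: ennreal_mult)
  then show "L \<noteq> \<infinity>" by (auto simp: ennreal_powr_def top_unique)
  assume a: "a \<ge> 0" "ennreal a \<le> L"
  then have "ennreal (a powr (1 / q)) \<le> ennreal (max C 0 * b powr (1 / p))"
    using order_trans[OF ennreal_powr_mono[OF a(2)] *] \<open>q > 0\<close> by (simp add: ennreal_powr_ennreal)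
  then show "a powr (1 / q) \<le> max C 0 * b powr (1 / p)"
    by (subst (asm) ennreal_le_iff) auto
qed

section \<open>The right-hand side for one Gaussian\<close>

lemma kor_powr_le:
  assumes "s \<ge> 0"
  shows "kor x powr s \<le> 3 ^ nat \<lceil>s\<rceil> * (1 + norm x) ^ nat \<lceil>s\<rceil>"
proof -
  have "kor x powr s \<le> (3 * (1 + norm x)) powr s"
    using assms kor_le[of x] by (intro powr_mono2) auto
  also have "\<dots> \<le> (3 * (1 + norm x)) powr real (nat \<lceil>s\<rceil>)"
  proof (rule powr_mono)
    show "1 \<le> 3 * (1 + norm x)" by (simp add: add_increasing2)
  qed (use assms in linarith)
  also have "\<dots> = (3 * (1 + norm x)) ^ nat \<lceil>s\<rceil>"
    by (rule powr_realpow) (simp add: add_pos_nonneg)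
  finally show ?thesis by (simp only: power_mult_distrib)
qed

text \<open>The exponent of \<open>e\<close> collects \<open>hdim\<close> from the change of
  variables, \<open>- hdim * p\<close> from the normalisation of the Gaussian and
  \<open>\<alpha> * p\<close> from the homogeneity of the gauge.\<close>

lemma pitt_rhs_hgauss:
  assumes "p \<ge> 1" "\<alpha> \<ge> 0"
  obtains W where "W \<ge> 0" "\<And>e. e > 0 \<Longrightarrow>
    pitt_rhs p \<alpha> (\<lambda>x :: 'n::finite heis. complex_of_real (hgauss e x))
      \<le> ennreal (W * e powr (real (hdim TYPE('n)) * (1 - p) + \<alpha> * p))"
proof
  let ?Q = "hdim TYPE('n)"
  let ?g = "\<lambda>x :: 'n heis. exp (- (norm x)\<^sup>2) powr p * kor x powr (\<alpha> * p)"
  let ?W = "LINT x|lborel. ?g x"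
  have int: "integrable lborel ?g"
  proof (rule integrable_poly_gaussian)
    show "?g \<in> borel_measurable borel" by measurable
    fix x :: "'n heis"
    have "exp (- (norm x)\<^sup>2) powr p \<le> exp (- (norm x)\<^sup>2) powr 1"
      using assms by (intro powr_mono') auto
    then have "?g x \<le> exp (- (norm x)\<^sup>2) * (3 ^ nat \<lceil>\<alpha> * p\<rceil> * (1 + norm x) ^ nat \<lceil>\<alpha> * p\<rceil>)"
      using assms by (intro mult_mono kor_powr_le) auto
    then show "norm (?g x) \<le> 3 ^ nat \<lceil>\<alpha> * p\<rceil> * (1 + norm x) ^ nat \<lceil>\<alpha> * p\<rceil> * exp (- (norm x)\<^sup>2)"
      by (simp add: mult_ac)
  qed
  show "?W \<ge> 0" by simp
  fix e :: real assume e: "e > 0"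
  have "pitt_rhs p \<alpha> (\<lambda>x :: 'n heis. complex_of_real (hgauss e x)) =
      (\<integral>\<^sup>+ (x :: 'n heis). ennreal (hgauss e x powr p * (kor x powr \<alpha>) powr p) \<partial>lborel)"
    using hgauss_nonneg[OF e] by (simp add: pitt_rhs_def v_weight_eq abs_of_nonneg[OF hgauss_nonneg[OF e]])
  also have "\<dots> = ennreal (e ^ ?Q) * (\<integral>\<^sup>+ (x :: 'n heis). ennreal (hgauss e (dil e x) powr p * (kor (dil e x) powr \<alpha>) powr p) \<partial>lborel)"
    by (rule nn_integral_dil[OF e]) measurable
  also have "(\<integral>\<^sup>+ (x :: 'n heis). ennreal (hgauss e (dil e x) powr p * (kor (dil e x) powr \<alpha>) powr p) \<partial>lborel)
     = (\<integral>\<^sup>+ (x :: 'n heis). ennreal (e powr (\<alpha> * p - real ?Q * p)) * ennreal (?g x) \<partial>lborel)"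
  proof (rule nn_integral_cong)
    fix x :: "'n heis"
    have "hgauss e (dil e x) = exp (- (norm x)\<^sup>2) / e powr real ?Q"
      unfolding powr_realpow[OF e] using hgauss_dil[OF e, of x] e by (simp add: field_simps)
    then have "hgauss e (dil e x) powr p * (kor (dil e x) powr \<alpha>) powr p = e powr (\<alpha> * p - real ?Q * p) * ?g x"
      using e by (simp add: kor_dil powr_mult powr_divide powr_powr powr_diff)
    then show "ennreal (hgauss e (dil e x) powr p * (kor (dil e x) powr \<alpha>) powr p) = ennreal (e powr (\<alpha> * p - real ?Q * p)) * ennreal (?g x)"
      by (simp flip: ennreal_mult)
  qed
  also have "\<dots> = ennreal (e powr (\<alpha> * p - real ?Q * p)) * ennreal ?W"
    by (subst nn_integral_cmult) (auto simp: nn_integral_eq_integral[OF int])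
  also have "ennreal (e ^ ?Q) * \<dots> = ennreal (?W * (e powr real ?Q * e powr (\<alpha> * p - real ?Q * p)))"
  proof -
    have "ennreal a * (ennreal b * ennreal c) = ennreal (c * (a * b))" if "a \<ge> 0" "b \<ge> 0" "c \<ge> 0" for a b c
      using that by (simp add: mult_ac flip: ennreal_mult)
    then show ?thesis unfolding powr_realpow[OF e] using e \<open>?W \<ge> 0\<close> by simp
  qed
  also have "e powr real ?Q * e powr (\<alpha> * p - real ?Q * p) = e powr (real ?Q * (1 - p) + \<alpha> * p)"
    by (simp add: algebra_simps flip: powr_add)
  finally show "pitt_rhs p \<alpha> (\<lambda>x :: 'n heis. complex_of_real (hgauss e x))
      \<le> ennreal (?W * e powr (real ?Q * (1 - p) + \<alpha> * p))" by simp
qed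

section \<open>Sums of dyadic Gaussians\<close>

text \<open>Each scale matters mainly where the gauge of x is about \<open>(1 / 2) ^ j\<close>.
  Instead of counting such scales, every summand is dominated by an increment of one bounded
  increasing function along \<open>2 ^ j * kor x\<close>, so the sum telescopes to a bound free of
  \<open>j0\<close>, \<open>N\<close> and \<open>x\<close>.\<close>

lemma sum_hgauss_kor_bound:
  assumes M: "M \<ge> real (hdim TYPE('n::finite))"
  obtains D where "D \<ge> 0" "\<And>j0 N (x :: 'n heis). kor x powr M * (\<Sum>j=j0..<j0+N. hgauss ((1 / 2) ^ j) x) \<le> D"
proof -
  \<comment> \<open>One factor of the gauge is set aside for the increment of \<phi>; the remaining
    power \<open>M - 1\<close> is rounded up to a natural number.\<close>
  define m where "m = nat \<lceil>M - 1\<rceil>"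
  obtain B where B: "B \<ge> 0" "\<And>r :: real. r \<ge> 0 \<Longrightarrow> (1 + r) ^ (m + 2) * exp (- (1 * r\<^sup>2)) \<le> B"
    using one_plus_power_exp_bound[OF zero_less_one, of "m + 2"] by blast
  \<comment> \<open>28 = 4 * 7, from \<open>1 + s \<le> 4 * (1 + norm y)\<close> and
    \<open>1 + 2 * s \<le> 7 * (1 + norm y)\<close>, both consequences of
    \<open>kor_le\<close>.\<close>
  define D where "D = 3 ^ m * 28 * B"
  \<comment> \<open>Any bounded increasing profile telescopes. This one has an explicit increment
    from s to 2 s, which is linear at 0 and decays like 1/s, slowly enough to dominate the Gaussian
    profile.\<close>
  define \<phi> where "\<phi> t = t / (1 + t)" for t :: real
  have "D \<ge> 0" using B by (simp add: D_def)
  have M1: "M \<ge> 1" using M by simp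
  have profile: "kor y powr M * exp (- (norm y)\<^sup>2) \<le> D * (\<phi> (2 * kor y) - \<phi> (kor y))" for y :: "'n heis"
  proof -
    define s where "s = kor y"
    have s: "s \<ge> 0" by (simp add: s_def)
    have \<phi>: "\<phi> (2 * s) - \<phi> s = s / ((1 + s) * (1 + 2 * s))"
      using s by (simp add: \<phi>_def divide_simps) (simp add: algebra_simps)
    have lin: "1 + a \<le> 4 * (1 + b) \<and> 1 + 2 * a \<le> 7 * (1 + b)" if "a \<le> 3 * (1 + b)" "0 \<le> b" for a b :: real
      using that by auto
    have "s powr (M - 1) * ((1 + s) * (1 + 2 * s)) \<le>
        (3 ^ m * (1 + norm y) ^ m) * ((4 * (1 + norm y)) * (7 * (1 + norm y)))"
    proof (intro mult_mono)
      show "s powr (M - 1) \<le> 3 ^ m * (1 + norm y) ^ m"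
        unfolding s_def m_def using M1 by (intro kor_powr_le) simp
      show "1 + s \<le> 4 * (1 + norm y)" "1 + 2 * s \<le> 7 * (1 + norm y)"
        using lin[OF kor_le[of y] norm_ge_zero[of y]] by (auto simp: s_def)
    qed (use s in auto)
    also have "\<dots> = 3 ^ m * 28 * (1 + norm y) ^ (m + 2)"
    proof -
      have "(a * b) * ((4 * u) * (7 * u)) = a * 28 * (b * (u * u))" for a b u :: real by simp
      then show ?thesis by (simp only: power_add power2_eq_square)
    qed
    finally have "s powr (M - 1) * ((1 + s) * (1 + 2 * s)) * exp (- (norm y)\<^sup>2) \<le>
        3 ^ m * 28 * (1 + norm y) ^ (m + 2) * exp (- (norm y)\<^sup>2)"
      by (intro mult_right_mono) auto
    also have "\<dots> = 3 ^ m * 28 * ((1 + norm y) ^ (m + 2) * exp (- (1 * (norm y)\<^sup>2)))"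
      by simp
    also have "\<dots> \<le> D"
      unfolding D_def using B(2)[of "norm y"] by (intro mult_left_mono) auto
    finally have *: "s powr (M - 1) * ((1 + s) * (1 + 2 * s)) * exp (- (norm y)\<^sup>2) \<le> D" .
    have "s powr M = s powr (M - 1) * s"
      using s M1 by (cases "s = 0") (auto simp: powr_diff)
    then have "s powr M * exp (- (norm y)\<^sup>2) =
        (s powr (M - 1) * ((1 + s) * (1 + 2 * s)) * exp (- (norm y)\<^sup>2)) * (s / ((1 + s) * (1 + 2 * s)))"
      using s by (simp add: field_simps add_nonneg_eq_0_iff)
    also have "\<dots> \<le> D * (s / ((1 + s) * (1 + 2 * s)))"
      using * s by (intro mult_right_mono) auto
    finally show ?thesis by (simp add: \<phi> flip: s_def)
  qed
  have summand: "kor x powr M * hgauss ((1 / 2) ^ j) x \<le> D * (\<phi> (2 ^ Suc j * kor x) - \<phi> (2 ^ j * kor x))" for j and x :: "'n heis"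
  proof -
    define e :: real where "e = (1 / 2) ^ j"
    define y where "y = dil (2 ^ j) x"
    have e: "e > 0" "e \<le> 1" by (auto simp: e_def power_le_one)
    have ej: "e * 2 ^ j = 1" by (simp add: e_def flip: power_mult_distrib)
    have x: "dil e y = x"
      using ej by (simp add: dil_def y_def prod_eq_iff flip: power_mult_distrib mult.assoc)
    have ky: "kor y = 2 ^ j * kor x" by (simp add: y_def kor_dil)
    have "kor x powr M * hgauss e x = (e * kor y) powr M * (exp (- (norm y)\<^sup>2) / e ^ hdim TYPE('n))"
    proof -
      have "hgauss e x = exp (- (norm y)\<^sup>2) / e ^ hdim TYPE('n)"
        using hgauss_dil[OF e(1), of y] e(1) by (simp add: x field_simps)
      moreover have "kor x = e * kor y" using ej by (simp add: ky flip: mult.assoc)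
      ultimately show ?thesis by simp
    qed
    also have "\<dots> = e powr (M - real (hdim TYPE('n))) * (kor y powr M * exp (- (norm y)\<^sup>2))"
      unfolding powr_realpow[OF e(1), symmetric] using e by (simp add: powr_mult powr_diff)
    \<comment> \<open>Here \<open>M \<ge> hdim\<close> enters: all scales satisfy
      \<open>e \<le> 1\<close>, so a nonnegative power of \<open>e\<close> is at most 1.\<close>
    also have "\<dots> \<le> 1 * (kor y powr M * exp (- (norm y)\<^sup>2))"
      using e M by (intro mult_right_mono powr_le1) auto
    also have "\<dots> \<le> D * (\<phi> (2 * kor y) - \<phi> (kor y))"
      using profile[of y] by simp
    finally show ?thesis by (simp add: e_def ky mult.assoc)
  qed
  have "kor x powr M * (\<Sum>j=j0..<j0+N. hgauss ((1 / 2) ^ j) x) \<le> D" for j0 N and x :: "'n heis"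
  proof -
    have "kor x powr M * (\<Sum>j=j0..<j0+N. hgauss ((1 / 2) ^ j) x)
        \<le> (\<Sum>j=j0..<j0+N. D * (\<phi> (2 ^ Suc j * kor x) - \<phi> (2 ^ j * kor x)))"
      unfolding sum_distrib_left by (intro sum_mono summand)
    also have "\<dots> = D * (\<phi> (2 ^ (j0 + N) * kor x) - \<phi> (2 ^ j0 * kor x))"
      using sum_Suc_diff'[of j0 "j0 + N" "\<lambda>j. \<phi> (2 ^ j * kor x)"] by (simp flip: sum_distrib_left)
    also have "\<dots> \<le> D * 1"
    proof (intro mult_left_mono \<open>D \<ge> 0\<close>)
      have "\<phi> t \<le> 1" "\<phi> t \<ge> 0" if "t \<ge> 0" for t using that by (auto simp: \<phi>_def)
      from this(1)[of "2 ^ (j0 + N) * kor x"] this(2)[of "2 ^ j0 * kor x"]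
      show "\<phi> (2 ^ (j0 + N) * kor x) - \<phi> (2 ^ j0 * kor x) \<le> 1" by simp
    qed
    finally show ?thesis by simp
  qed
  with \<open>D \<ge> 0\<close> show thesis by (rule that)
qed

lemma pitt_rhs_sum_hgauss:
  assumes p: "p > 1" and \<alpha>: "\<alpha> > 0" and p': "1 / p + 1 / p' = 1"
    and ge: "\<alpha> * p' \<ge> real (hdim TYPE('n::finite))"
  obtains D where "D \<ge> 0" "\<And>j0 N. pitt_rhs p \<alpha> (\<lambda>x :: 'n heis. complex_of_real (\<Sum>j=j0..<j0+N. hgauss ((1 / 2) ^ j) x))
    \<le> ennreal (D * real N)"
proof -
  obtain D where D: "D \<ge> 0" "\<And>j0 N (x :: 'n heis). kor x powr (\<alpha> * p') * (\<Sum>j=j0..<j0+N. hgauss ((1 / 2) ^ j) x) \<le> D"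
    using sum_hgauss_kor_bound[OF ge] by blast
  \<comment> \<open>This identity rewrites v^p as (v^p')^(p - 1), so that F^(p - 1) v^p becomes a
    power of the bounded product v^p' F.\<close>
  have pp: "p' * (p - 1) = p"
  proof -
    have "p' \<noteq> 0" using p p' by auto
    then show ?thesis using p p' by (simp add: field_simps)
  qed
  show thesis
  proof (rule that)
    show "D powr (p - 1) * gauss_mass TYPE('n) \<ge> 0" using gauss_mass_pos[where 'n='n] by simp
    fix j0 N
    let ?F = "\<lambda>x :: 'n heis. \<Sum>j=j0..<j0+N. hgauss ((1 / 2) ^ j) x"
    have F: "?F x \<ge> 0" for x by (intro sum_nonneg hgauss_nonneg) auto
    have "?F x powr p * v_weight \<alpha> x powr p \<le> D powr (p - 1) * ?F x" for x
    proof -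
      have "?F x powr p * v_weight \<alpha> x powr p = ?F x * (?F x powr (p - 1) * kor x powr (\<alpha> * p))"
      proof (cases "?F x = 0")
        case False
        then have "?F x powr p = ?F x powr (p - 1) * ?F x"
          using F[of x] by (simp add: powr_diff)
        then show ?thesis by (simp add: v_weight_eq powr_powr)
      qed simp
      also have "kor x powr (\<alpha> * p) = (kor x powr (\<alpha> * p')) powr (p - 1)"
        by (simp add: powr_powr mult.assoc pp)
      also have "?F x powr (p - 1) * \<dots> = (kor x powr (\<alpha> * p') * ?F x) powr (p - 1)"
        using F[of x] by (simp add: powr_mult mult.commute)
      also have "?F x * \<dots> \<le> ?F x * D powr (p - 1)"
        using D(2)[of x j0 N] F[of x] p by (intro mult_left_mono powr_mono2) auto
      finally show ?thesis by (simp add: mult.commute)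
    qed
    then have "pitt_rhs p \<alpha> (\<lambda>x. complex_of_real (?F x)) \<le> (\<integral>\<^sup>+ x. ennreal (D powr (p - 1) * ?F x) \<partial>lborel)"
      unfolding pitt_rhs_def norm_of_real abs_of_nonneg[OF F] by (intro nn_integral_mono ennreal_leI) auto
    also have "\<dots> = ennreal (LINT x|lborel. D powr (p - 1) * ?F x)"
      using F by (intro nn_integral_eq_integral integrable_mult_right Bochner_Integration.integrable_sum integrable_hgauss) auto
    also have "(LINT x|lborel. D powr (p - 1) * ?F x) = D powr (p - 1) * gauss_mass TYPE('n) * real N"
      by (subst integral_mult_right_zero, subst Bochner_Integration.integral_sum)
         (auto intro!: integrable_hgauss simp: integral_hgauss)
    finally show "pitt_rhs p \<alpha> (\<lambda>x. complex_of_real (?F x)) \<le> ennreal (D powr (p - 1) * gauss_mass TYPE('n) * real N)" .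
  qed
qed

section \<open>Necessary conditions\<close>

text \<open>\<open>N\<close> carries the type \<open>'n\<close>, which no other parameter
  mentions.\<close>

locale pitt_inequality =
  fixes N :: "'n::finite itself" and p q \<alpha> \<sigma> \<rho> C :: real
  assumes p: "1 < p" and q: "1 < q" and \<alpha>: "0 < \<alpha>" and \<rho>: "0 < \<rho>"
    and pitt: "\<And>f :: 'n heis \<Rightarrow> complex. schwartz f \<Longrightarrow>
      ennreal_powr (pitt_lhs q \<sigma> \<rho> f) (1 / q) \<le> ennreal C * ennreal_powr (pitt_rhs p \<alpha> f) (1 / p)"
begin

text \<open>The threshold for \<open>B * (e\<^sup>2 + r\<^sup>2)\<close> below which at least half
  of the mass of a Gaussian survives in its transform.\<close>

definition c0 :: real where "c0 = gauss_mass TYPE('n) / (2 * gauss_moment TYPE('n))"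

definition \<kappa> :: real where "\<kappa> = real CARD('n) powr (- (\<sigma> * q)) / (2 * pi) ^ (2 * CARD('n) + 1)"

lemma c0_pos: "c0 > 0"
  using gauss_mass_pos[where 'n='n] gauss_moment_pos[where 'n='n] by (simp add: c0_def)

lemma \<kappa>_pos: "\<kappa> > 0"
  by (simp add: \<kappa>_def)

lemma schwartz_sum_hgauss:
  assumes "finite J" "\<And>j. j \<in> J \<Longrightarrow> e j > 0"
  shows "schwartz (\<lambda>x :: 'n heis. complex_of_real (\<Sum>j\<in>J. hgauss (e j) x))"
  unfolding of_real_sum using assms by (intro schwartz_sum schwartz_hgauss) auto

lemma pitt_lhs_sum_hgauss_lower:
  assumes J: "finite J" "\<And>j. j \<in> J \<Longrightarrow> e j > 0" and small: "\<And>j. j \<in> J \<Longrightarrow> B * ((e j)\<^sup>2 + r\<^sup>2) \<le> c0"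
  shows "ennreal ((real (card J) * (gauss_mass TYPE('n) / 2)) powr q * \<kappa>) *
      (ray_mass (2 * real CARD('n) - \<sigma> * q) B * ball_mass TYPE('n) (\<rho> * q) r)
    \<le> pitt_lhs q \<sigma> \<rho> (\<lambda>x :: 'n heis. complex_of_real (\<Sum>j\<in>J. hgauss (e j) x))"
  unfolding \<kappa>_def
proof (rule pitt_lhs_lower)
  show "0 \<le> real (card J) * (gauss_mass TYPE('n) / 2)" using gauss_mass_pos[where 'n='n] by simp
  fix l and w :: "complex ^ 'n" assume l: "1 < l" "l < B" and w: "norm w \<le> r"
  show "real (card J) * (gauss_mass TYPE('n) / 2) \<le> norm (strichartz_ft_normalized
    (\<lambda>x :: 'n heis. complex_of_real (\<Sum>j\<in>J. hgauss (e j) x)) (l, real CARD('n) * \<bar>l\<bar>) w)"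
  proof (rule strichartz_ft_sum_hgauss_lower[OF J])
    fix j assume j: "j \<in> J"
    have "\<bar>l\<bar> * ((e j)\<^sup>2 + (norm w)\<^sup>2) \<le> B * ((e j)\<^sup>2 + r\<^sup>2)"
      using l w by (intro mult_mono add_left_mono power_mono) auto
    with small[OF j] show "\<bar>l\<bar> * ((e j)\<^sup>2 + (norm w)\<^sup>2) \<le> gauss_mass TYPE('n) / (2 * gauss_moment TYPE('n))"
      by (simp add: c0_def)
  qed (use l in auto)
qed (use q in auto)

lemma pitt_lhs_hgauss_lower:
  assumes "e > 0" "B * (e\<^sup>2 + r\<^sup>2) \<le> c0"
  shows "ennreal ((gauss_mass TYPE('n) / 2) powr q * \<kappa>) *
      (ray_mass (2 * real CARD('n) - \<sigma> * q) B * ball_mass TYPE('n) (\<rho> * q) r)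
    \<le> pitt_lhs q \<sigma> \<rho> (\<lambda>x :: 'n heis. complex_of_real (hgauss e x))"
  using pitt_lhs_sum_hgauss_lower[of "{0 :: nat}" "\<lambda>_. e" B r] assms by simp

lemma rho_condition: "q * \<rho> < 2 * real CARD('n)"
proof (rule ccontr)
  assume neg: "\<not> q * \<rho> < 2 * real CARD('n)"
  \<comment> \<open>With \<open>B = 2\<close> and \<open>e = r\<close> the smallness condition reads
    4 r^2 <= c0.\<close>
  define r where "r = sqrt c0 / 2"
  have r: "r > 0" "2 * (r\<^sup>2 + r\<^sup>2) \<le> c0"
    using c0_pos by (auto simp: r_def power_divide)
  let ?f = "\<lambda>x :: 'n heis. complex_of_real (hgauss r x)"
  have "ball_mass TYPE('n) (\<rho> * q) r = \<infinity>"
    using neg by (intro ball_mass_eq_top r) (simp add: mult.commute)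
  moreover have "ray_mass (2 * real CARD('n) - \<sigma> * q) 2 \<noteq> 0"
  proof -
    have "0 < ennreal (min 1 (2 powr (2 * real CARD('n) - \<sigma> * q)))" by (simp add: min_def)
    then show ?thesis
      using ray_mass_ge_const[of 2 "2 * real CARD('n) - \<sigma> * q"] by (metis leD order_refl)
  qed
  moreover have "ennreal ((gauss_mass TYPE('n) / 2) powr q * \<kappa>) \<noteq> 0"
    using gauss_mass_pos[where 'n='n] \<kappa>_pos by simp
  ultimately have "pitt_lhs q \<sigma> \<rho> ?f = \<infinity>"
    using pitt_lhs_hgauss_lower[OF r] by (simp add: ennreal_mult_eq_top_iff top_unique)
  moreover obtain W where W: "W \<ge> 0" "\<And>e. e > 0 \<Longrightarrow>
    pitt_rhs p \<alpha> (\<lambda>x :: 'n heis. complex_of_real (hgauss e x))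
      \<le> ennreal (W * e powr (real (hdim TYPE('n)) * (1 - p) + \<alpha> * p))"
    using pitt_rhs_hgauss[of p \<alpha>] p \<alpha> by (metis less_imp_le)
  have "pitt_lhs q \<sigma> \<rho> ?f \<noteq> \<infinity>"
    using p q W(1) by (intro pitt_bound(1)[OF pitt[OF schwartz_hgauss[OF r(1)]] _ _ W(2)[OF r(1)]]) auto
  ultimately show False by contradiction
qed

lemma alpha_condition:
  assumes p': "1 / p + 1 / p' = 1"
  shows "\<alpha> * p' < 2 * (1 + real CARD('n))"
proof (rule ccontr)
  assume "\<not> \<alpha> * p' < 2 * (1 + real CARD('n))"
  then have ge: "\<alpha> * p' \<ge> real (hdim TYPE('n))" by simp
  obtain D where D: "D \<ge> 0" "\<And>j0 N. pitt_rhs p \<alpha> (\<lambda>x :: 'n heis. complex_of_real (\<Sum>j=j0..<j0+N. hgauss ((1 / 2) ^ j) x))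
    \<le> ennreal (D * real N)"
    using pitt_rhs_sum_hgauss[OF p \<alpha> p' ge] by blast
  define r where "r = sqrt c0 / 2"
  have r: "r > 0" "2 * (r\<^sup>2 + r\<^sup>2) \<le> c0"
    using c0_pos by (auto simp: r_def power_divide)
  \<comment> \<open>Smallness limits the scales from above only, so any number of dyadic scales
    beyond \<open>j0\<close> may be added with \<open>r\<close> and \<open>B = 2\<close>
    fixed.\<close>
  obtain j0 where j0: "(1 / 2 :: real) ^ j0 < r"
    using real_arch_pow_inv[OF r(1), of "1 / 2"] by auto
  \<comment> \<open>Everything in the lower bound that does not depend on \<open>N\<close>.\<close>
  define a where "a = (gauss_mass TYPE('n) / 2) powr q * \<kappa> * (min 1 (2 powr (2 * real CARD('n) - \<sigma> * q)) *
    (unit_ball_vol (real (2 * CARD('n))) * r powr (2 * real CARD('n) - \<rho> * q)))"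
  have a: "a > 0"
    using gauss_mass_pos[where 'n='n] \<kappa>_pos r by (simp add: a_def)
  have bound: "real N * a powr (1 / q) \<le> max C 0 * (D * real N) powr (1 / p)" for N
  proof -
    let ?f = "\<lambda>x :: 'n heis. complex_of_real (\<Sum>j=j0..<j0+N. hgauss ((1 / 2) ^ j) x)"
    have small: "2 * (((1 / 2) ^ j)\<^sup>2 + r\<^sup>2) \<le> c0" if "j \<in> {j0..<j0+N}" for j
    proof -
      have "(1 / 2 :: real) ^ j \<le> (1 / 2) ^ j0"
        using that by (intro power_decreasing) auto
      then have "(1 / 2 :: real) ^ j \<le> r" using j0 by linarith
      then have "((1 / 2 :: real) ^ j)\<^sup>2 \<le> r\<^sup>2" by (intro power_mono) auto
      then show ?thesis using r(2) by simp
    qed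
    have "ennreal (real N powr q * a) = ennreal ((real N * (gauss_mass TYPE('n) / 2)) powr q * \<kappa>) *
       (ennreal (min 1 (2 powr (2 * real CARD('n) - \<sigma> * q))) *
        ennreal (unit_ball_vol (real (2 * CARD('n))) * r powr (2 * real CARD('n) - \<rho> * q)))"
      using gauss_mass_pos[where 'n='n] \<kappa>_pos
      unfolding a_def powr_mult[of "real N"] by (simp add: mult_ac flip: ennreal_mult)
    also have "\<dots> \<le> ennreal ((real N * (gauss_mass TYPE('n) / 2)) powr q * \<kappa>) *
       (ray_mass (2 * real CARD('n) - \<sigma> * q) 2 * ball_mass TYPE('n) (\<rho> * q) r)"
      using r q \<rho> by (intro mult_left_mono mult_mono ray_mass_ge_const ball_mass_ge) auto
    also have "\<dots> \<le> pitt_lhs q \<sigma> \<rho> ?f"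
      using pitt_lhs_sum_hgauss_lower[of "{j0..<j0+N}" "\<lambda>j. (1 / 2) ^ j" 2 r, OF _ _ small] by simp
    finally have "ennreal (real N powr q * a) \<le> pitt_lhs q \<sigma> \<rho> ?f" .
    moreover have "schwartz ?f" by (rule schwartz_sum_hgauss) auto
    ultimately have "(real N powr q * a) powr (1 / q) \<le> max C 0 * (D * real N) powr (1 / p)"
      using p q a D by (intro pitt_bound(2)[OF pitt]) auto
    then show ?thesis using q a by (simp add: powr_mult powr_powr)
  qed
  define K where "K = max C 0 * D powr (1 / p) / a powr (1 / q)"
  have K: "real N powr (1 - 1 / p) \<le> K" if "N > 0" for N
  proof -
    have "real N powr (1 - 1 / p) * real N powr (1 / p) = real N"
      using that by (simp flip: powr_add)
    then have "real N powr (1 - 1 / p) * real N powr (1 / p) * a powr (1 / q) \<le> max C 0 * D powr (1 / p) * real N powr (1 / p)"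
      using bound[of N] D by (simp add: powr_mult mult.assoc)
    then have "real N powr (1 / p) * (real N powr (1 - 1 / p) * a powr (1 / q)) \<le> real N powr (1 / p) * (max C 0 * D powr (1 / p))"
      by (simp only: mult_ac)
    then have "real N powr (1 - 1 / p) * a powr (1 / q) \<le> max C 0 * D powr (1 / p)"
      using that by (subst (asm) mult_le_cancel_left_pos) auto
    then show ?thesis using a by (simp add: K_def pos_le_divide_eq)
  qed
  have t: "1 - 1 / p > 0" using p by simp
  \<comment> \<open>The exponent is p'; \<open>max 1 K\<close> keeps the base of the power
    positive.\<close>
  obtain N :: nat where N: "real N > max 1 K powr (1 / (1 - 1 / p))"
    using reals_Archimedean2 by blast
  have "0 < max 1 K powr (1 / (1 - 1 / p))" by simp
  with N have "N > 0" by (cases N) auto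
  have "max 1 K = (max 1 K powr (1 / (1 - 1 / p))) powr (1 - 1 / p)"
    using t p by (simp add: powr_powr)
  also have "\<dots> < real N powr (1 - 1 / p)"
    using N t by (intro powr_less_mono2) auto
  finally show False using K[OF \<open>N > 0\<close>] by simp
qed

text \<open>\<open>j\<close> stands for any real minorant of the ray integral, so the scaling cases
  differ only in the minorant inserted.\<close>

lemma scaling_bound:
  defines "E \<equiv> - \<alpha> / 2 + (real CARD('n) + 1) * (1 - 1 / p) + (2 * real CARD('n) - q * \<rho>) / (2 * q)"
  obtains K where "\<And>B j. B \<ge> 2 \<Longrightarrow> j \<ge> 0 \<Longrightarrow> ennreal j \<le> ray_mass (2 * real CARD('n) - \<sigma> * q) B \<Longrightarrow>
    j \<le> K * B powr (q * E)"
proof -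
  let ?n = "real CARD('n)"
  define \<theta> where "\<theta> = real (hdim TYPE('n)) * (1 - p) + \<alpha> * p"
  obtain W where W: "W \<ge> 0" "\<And>e. e > 0 \<Longrightarrow>
    pitt_rhs p \<alpha> (\<lambda>x :: 'n heis. complex_of_real (hgauss e x)) \<le> ennreal (W * e powr \<theta>)"
    using pitt_rhs_hgauss[of p \<alpha>] p \<alpha> unfolding \<theta>_def by (metis less_imp_le)
  define A where "A = (gauss_mass TYPE('n) / 2) powr q * \<kappa> * unit_ball_vol (real (2 * CARD('n)))"
  have A: "A > 0" using gauss_mass_pos[where 'n='n] \<kappa>_pos by (simp add: A_def)
  define K where "K = (max C 0 * W powr (1 / p)) powr q / A * (c0 / 2) powr (- (q * E))"
  have "j \<le> K * B powr (q * E)" if B: "B \<ge> 2" and j: "j \<ge> 0" "ennreal j \<le> ray_mass (2 * ?n - \<sigma> * q) B" for B j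
  proof -
    \<comment> \<open>The largest scale allowed for the given \<open>B\<close> when the radius in w
      equals \<open>e\<close>.\<close>
    define e where "e = sqrt (c0 / (2 * B))"
    have e: "e > 0" and e2: "e\<^sup>2 = c0 / (2 * B)" using c0_pos B by (auto simp: e_def)
    have small: "B * (e\<^sup>2 + e\<^sup>2) \<le> c0" using B by (simp add: e2)
    let ?f = "\<lambda>x :: 'n heis. complex_of_real (hgauss e x)"
    have "ennreal (A * j * e powr (2 * ?n - \<rho> * q)) = ennreal ((gauss_mass TYPE('n) / 2) powr q * \<kappa>) *
        (ennreal j * ennreal (unit_ball_vol (real (2 * CARD('n))) * e powr (2 * ?n - \<rho> * q)))"
      using j \<kappa>_pos by (simp add: A_def mult_ac flip: ennreal_mult)
    also have "\<dots> \<le> ennreal ((gauss_mass TYPE('n) / 2) powr q * \<kappa>) *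
        (ray_mass (2 * ?n - \<sigma> * q) B * ball_mass TYPE('n) (\<rho> * q) e)"
      using e q \<rho> j by (intro mult_left_mono mult_mono ball_mass_ge) auto
    also have "\<dots> \<le> pitt_lhs q \<sigma> \<rho> ?f" by (rule pitt_lhs_hgauss_lower[OF e small])
    finally have "(A * j * e powr (2 * ?n - \<rho> * q)) powr (1 / q) \<le> max C 0 * (W * e powr \<theta>) powr (1 / p)"
      using p q W A j by (intro pitt_bound(2)[OF pitt[OF schwartz_hgauss[OF e]] _ _ W(2)[OF e]]) auto
    then have "((A * j * e powr (2 * ?n - \<rho> * q)) powr (1 / q)) powr q \<le> (max C 0 * (W * e powr \<theta>) powr (1 / p)) powr q"
      using q by (intro powr_mono2) auto
    then have "A * j * e powr (2 * ?n - \<rho> * q) \<le> (max C 0 * W powr (1 / p)) powr q * e powr (\<theta> / p * q)"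
      using q A j W by (simp add: powr_powr powr_mult)
    then have "j \<le> (max C 0 * W powr (1 / p)) powr q / A * (e powr (\<theta> / p * q) / e powr (2 * ?n - \<rho> * q))"
      using A e by (simp add: field_simps)
    \<comment> \<open>The exponent collects to - 2 q E, and e^2 is inversely proportional to B; this
      turns it into the exponent q E of B.\<close>
    also have "e powr (\<theta> / p * q) / e powr (2 * ?n - \<rho> * q) = e powr (2 * (- (q * E)))"
    proof -
      have "\<theta> / p * q - (2 * ?n - \<rho> * q) = 2 * (- (q * E))"
        using p q by (simp add: \<theta>_def E_def field_simps)
      then show ?thesis by (simp flip: powr_diff)
    qed
    also have "e powr (2 * (- (q * E))) = (e\<^sup>2) powr (- (q * E))"
      using e powr_powr[of e 2 "- (q * E)"] by simp
    also have "\<dots> = (c0 / 2) powr (- (q * E)) * B powr (q * E)"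
    proof -
      have eq: "e\<^sup>2 = c0 / 2 / B" by (simp add: e2)
      show ?thesis unfolding eq using c0_pos B by (simp add: powr_divide powr_mult powr_minus field_simps)
    qed
    finally show ?thesis by (simp add: K_def mult.assoc)
  qed
  then show thesis by (rule that)
qed

end

lemma powr_bound_imp_exponent_le:
  fixes a b c K :: real
  assumes "c > 0" "\<And>B. B \<ge> 2 \<Longrightarrow> c * B powr a \<le> K * B powr b"
  shows "a \<le> b"
proof (rule ccontr)
  assume "\<not> a \<le> b"
  define t where "t = a - b"
  have t: "t > 0" using \<open>\<not> a \<le> b\<close> by (simp add: t_def)
  \<comment> \<open>Makes \<open>B powr t\<close> exceed \<open>\<bar>K\<bar> / c\<close>, whatever
    the sign of \<open>K\<close>.\<close>
  define B where "B = max 2 ((\<bar>K\<bar> / c + 1) powr (1 / t))"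
  have B: "B \<ge> 2" by (simp add: B_def)
  have "c * B powr t * B powr b \<le> K * B powr b"
    using assms(2)[OF B] B by (simp add: t_def mult.assoc flip: powr_add)
  then have "c * B powr t \<le> K" using B by (subst (asm) mult_le_cancel_right_pos) auto
  moreover have "\<bar>K\<bar> / c + 1 \<le> B powr t"
  proof -
    have "\<bar>K\<bar> / c + 1 = ((\<bar>K\<bar> / c + 1) powr (1 / t)) powr t"
      using t \<open>c > 0\<close> by (simp add: powr_powr add_nonneg_pos)
    also have "\<dots> \<le> B powr t" using t by (intro powr_mono2) (auto simp: B_def)
    finally show ?thesis .
  qed
  then have "c * (\<bar>K\<bar> / c + 1) \<le> c * B powr t" using \<open>c > 0\<close> by (intro mult_left_mono) auto
  then have "\<bar>K\<bar> + c \<le> c * B powr t" using \<open>c > 0\<close> by (simp add: distrib_left)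
  ultimately show False using \<open>c > 0\<close> by linarith
qed

theorem theorem5p4p3:
  fixes p q p' \<alpha> \<sigma> \<rho> :: real
  assumes "1 < p" and "1 < q" and "1 / p + 1 / p' = 1"
    and "0 < \<alpha>" and "0 < \<sigma>" and "0 < \<rho>"
    and pitt: "\<exists>C::real. \<forall>f :: 'n::finite heis \<Rightarrow> complex. schwartz f \<longrightarrow>
      ennreal_powr
        (\<integral>\<^sup>+ (a, w). ennreal (norm (strichartz_ft_normalized f a w) powr q
                              * u_weight \<sigma> \<rho> a w powr q)
           \<partial>(nu2 CARD('n) \<Otimes>\<^sub>M lborel)) (1 / q)
      \<le> ennreal C * ennreal_powr
        (\<integral>\<^sup>+ x. ennreal (norm (f x) powr p * v_weight \<alpha> x powr p) \<partial>lborel) (1 / p)"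
  shows "0 < \<alpha> \<and> 0 < \<sigma> \<and> 0 < \<rho> \<and>
    \<alpha> * p' < 2 * (1 + real CARD('n)) \<and>
    q * \<rho> < 2 * real CARD('n) \<and>
    (q * \<sigma> < 2 * real CARD('n) + 1 \<longrightarrow>
      - \<alpha> / 2 + (real CARD('n) + 1) / p' + (2 * real CARD('n) - q * \<rho>) / (2 * q)
        + (- 2 * real CARD('n) + q * \<sigma> - 1) / q \<ge> 0) \<and>
    (q * \<sigma> = 2 * real CARD('n) + 1 \<longrightarrow>
      - \<alpha> / 2 + (real CARD('n) + 1) / p' + (2 * real CARD('n) - q * \<rho>) / (2 * q) > 0) \<and>
    (q * \<sigma> > 2 * real CARD('n) + 1 \<longrightarrow>
      - \<alpha> / 2 + (real CARD('n) + 1) / p' + (2 * real CARD('n) - q * \<rho>) / (2 * q) \<ge> 0)"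
proof -
  obtain C :: real where C: "\<And>f :: 'n heis \<Rightarrow> complex. schwartz f \<Longrightarrow>
      ennreal_powr (pitt_lhs q \<sigma> \<rho> f) (1 / q) \<le> ennreal C * ennreal_powr (pitt_rhs p \<alpha> f) (1 / p)"
    using pitt unfolding pitt_lhs_def pitt_rhs_def by blast
  interpret pitt_inequality "TYPE('n)" p q \<alpha> \<sigma> \<rho> C
    by unfold_locales (use assms C in auto)
  let ?n = "real CARD('n)"
  define E where "E = - \<alpha> / 2 + (?n + 1) / p' + (2 * ?n - q * \<rho>) / (2 * q)"
  have "1 - 1 / p = 1 / p'" using assms(3) by simp
  then have E: "E = - \<alpha> / 2 + (?n + 1) * (1 - 1 / p) + (2 * ?n - q * \<rho>) / (2 * q)"
    by (simp add: E_def)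
  obtain K where K: "\<And>B j. B \<ge> 2 \<Longrightarrow> j \<ge> 0 \<Longrightarrow> ennreal j \<le> ray_mass (2 * ?n - \<sigma> * q) B \<Longrightarrow>
    j \<le> K * B powr (q * E)"
    using scaling_bound unfolding E by blast
  have "E + (- 2 * ?n + q * \<sigma> - 1) / q \<ge> 0"
  proof -
    let ?s = "2 * ?n - \<sigma> * q"
    \<comment> \<open>Since \<open>?s + 1\<close> is 2 n + 1 - q \<sigma>, dividing by
      \<open>q\<close> gives the claimed inequality.\<close>
    have "?s + 1 \<le> q * E"
    proof (rule powr_bound_imp_exponent_le)
      show "min ((1 / 2) powr ?s) 1 / 2 > 0" by (simp add: min_def)
      show "min ((1 / 2) powr ?s) 1 / 2 * B powr (?s + 1) \<le> K * B powr (q * E)" if "B \<ge> 2" for B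
        by (rule K[OF that _ ray_mass_ge_dyadic[OF that]]) simp
    qed
    then show ?thesis using \<open>1 < q\<close> by (simp add: field_simps)
  qed
  moreover have "E > 0" if "q * \<sigma> = 2 * ?n + 1"
  proof (rule ccontr)
    assume "\<not> E > 0"
    \<comment> \<open>For E <= 0 the right side of the scaling bound is at most
      \<open>\<bar>K\<bar>\<close>, while \<open>ln B\<close> equals
      \<open>\<bar>K\<bar> + 1\<close>.\<close>
    define B where "B = exp (\<bar>K\<bar> + 1)"
    have B: "B \<ge> 2" using exp_ge_add_one_self[of "\<bar>K\<bar> + 1"] by (simp add: B_def)
    have s: "2 * ?n - \<sigma> * q = - 1" using that by (simp add: mult.commute)
    have "ln B \<le> K * B powr (q * E)"
      using B by (intro K) (auto simp: s ray_mass_minus_one)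
    also have "\<dots> \<le> \<bar>K\<bar> * 1"
    proof (rule mult_mono)
      have "B powr (q * E) \<le> B powr 0"
        using B \<open>\<not> E > 0\<close> \<open>1 < q\<close> by (intro powr_mono) (auto simp: mult_nonneg_nonpos)
      then show "B powr (q * E) \<le> 1" using B by simp
    qed auto
    finally show False by (simp add: B_def)
  qed
  moreover have "E \<ge> 0"
  proof -
    let ?s = "2 * ?n - \<sigma> * q"
    have "0 \<le> q * E"
    proof (rule powr_bound_imp_exponent_le)
      show "min 1 (2 powr ?s) > 0" by (simp add: min_def)
      \<comment> \<open>The bottom block does not grow with \<open>B\<close>; it is compared as the
        power \<open>B powr 0\<close>.\<close>
      show "min 1 (2 powr ?s) * B powr 0 \<le> K * B powr (q * E)" if "B \<ge> 2" for B
        using K[OF that _ ray_mass_ge_const[OF that]] that by simp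
    qed
    then show ?thesis using \<open>1 < q\<close> by (simp add: zero_le_mult_iff)
  qed
  ultimately show ?thesis
    using assms alpha_condition[OF assms(3)] rho_condition by (simp add: E_def)
qed

end
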